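(* Fix $d\ge1$, $s\in(0,1]$, $L_H>0$ and $M_w>0$. Suppose that $w:\overline\Omega_L\to[0,\infty)$ is bounded and Lipschitz, vanishes on $\Delta_L$, and satisfies $w(u)>0$ for every $u\in\Omega_L$. Let $\mathcal P_{\mathrm{bm}}(s,L_H,M_w)$ be the class of joint laws $P$ of $(Z,D)$ such that: (1) $Z$ is uniformly distributed on $\mathcal Z=[0,1]^d$; (2) $D$ is a persistence diagram supported in $\Omega_L$ and $\mu_D^w(\overline\Omega_L)\le M_w$ almost surely; (3) the conditional weighted mean measure $\Lambda_z^w(A)=\mathbb E_P[\mu_D^w(A)\mid Z=z]$ admits a density $\lambda_{w,P}(z,u)$ with respect to Lebesgue measure on $\overline\Omega_L$ belonging to $\Sigma(s,L_H)$. Fix kernels $K_Z:\mathbb R^d\to[0,\infty)$ and $K_U:\mathbb R^2\to[0,\infty)$ that are bounded, Lipschitz, integrate to one, are supported in the closed unit balls of $\mathbb R^d$ and $\mathbb R^2$, and are bounded below by positive constants on neighbourhoods of the origin. Choose $$h_Z\asymp h_U\asymp\left(\frac{\log n}{n}\right)^{1/(2s+d+2)},\qquad \varrho_n:=\left(\frac{\log n}{n}\right)^{s/(2s+d+2)},$$ and fix $\delta\in(0,1)$. Then there is $C_\delta<\infty$, depending only on $d,s,L_H,M_w,w,L$, the kernels, $\delta$ (and the proportionality constants in the choice of bandwidths), such that, for all sufficiently large $n$, $$\sup_{P\in\mathcal P_{\mathrm{bm}}(s,L_H,M_w)}P^{\otimes n}\left(\|\widehat\lambda_{w,n}-\lam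bda_{w,P}\|_\infty>C_\delta\varrho_n\right)\le\delta.$$
   Context: Fix $L>0$ and let $\Omega_L=\{(b,t):0\le b<t\le L\}$, $\overline\Omega_L=\{(b,t):0\le b\le t\le L\}$, $\Delta_L=\{(b,b):0\le b\le L\}$. $\|\cdot\|$ is the Euclidean norm. A persistence diagram $D$ supported in $\Omega_L$ is identified with a locally finite counting measure $\mu_D=\sum_{x\in D}a_x\delta_x$, $a_x\in\mathbb N$, and $\mu_D^w(A)=\int_Aw\,d\mu_D$ for Borel $A\subseteq\overline\Omega_L$. $\|g\|_\infty=\sup_{z\in\mathcal Z,u\in\overline\Omega_L}|g(z,u)|$. $\Sigma(s,L_H)$ is the class of functions $g:\mathcal Z\times\overline\Omega_L\to\mathbb R$ with $|g(z,u)-g(z',u')|\le L_H(\|z-z'\|+\|u-u'\|)^s$ for all $z,z'\in\mathcal Z$, $u,u'\in\overline\Omega_L$. $P^{\otimes n}$ is the law of $n$ i.i.d. pairs $(Z_i,D_i)\sim P$; $\mu_i^w=\mu_{D_i}^w$. For $h>0$ define $c_{Z,h}(z)=\int_{\mathcal Z}h^{-d}K_Z((z'-z)/h)\,dz'$, $c_{U,h}(u)=\int_{\overline\Omega_L}h^{-2}K_U((v-u)/h)\,dv$, $\kappa_{Z,h}(z,z')=h^{-d}K_Z((z'-z)/h)/c_{Z,h}(z)$, $\kappa_{U,h}(u,v)=h^{-2}K_U((v-u)/h)/c_{U,h}(u)$. Set $Y^w_{i,h_U}(u)=\int_{\overline\Omega_L}\kappa_{U,h_U}(u,v)\,d\mu_i^w(v)$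 and $$\widehat\lambda_{w,n}(z,u)=\frac{\sum_{i=1}^n\kappa_{Z,h_Z}(z,Z_i)Y^w_{i,h_U}(u)}{\sum_{i=1}^n\kappa_{Z,h_Z}(z,Z_i)},$$ with value $0$ when the denominator is zero. $a_n\asymp b_n$ means that $a_n/b_n$ is bounded above and below by positive constants for large $n$. *)

theory Defs
  imports "HOL-Probability.Probability"
begin

definition unit_cube :: "(real ^ 'n) set" where
  "unit_cube = cbox 0 1"

definition tri :: "real \<Rightarrow> (real \<times> real) set" where
  "tri L = {(b, t). 0 \<le> b \<and> b < t \<and> t \<le> L}"

definition cltri :: "real \<Rightarrow> (real \<times> real) set" where
  "cltri L = {(b, t). 0 \<le> b \<and> b \<le> t \<and> t \<le> L}"

definition diag :: "real \<Rightarrow> (real \<times> real) set" where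
  "diag L = {(b, b) | b. 0 \<le> b \<and> b \<le> L}"


section \<open>Persistence diagrams and their measures\<close>

text \<open>A diagram is given by its multiplicity function \<open>x \<mapsto> a\<^sub>x\<close>. It is locally finite on the
  half-open triangle, so infinitely many points may accumulate at the diagonal.\<close>

type_synonym diagram = "real \<times> real \<Rightarrow> nat"

definition diagrams :: "real \<Rightarrow> diagram set" where
  "diagrams L = {D. {x. D x \<noteq> 0} \<subseteq> tri L \<and>
     (\<forall>K. compact K \<longrightarrow> K \<subseteq> tri L \<longrightarrow> finite {x \<in> K. D x \<noteq> 0})}"

text \<open>The measure \<open>\<Sum>\<^sub>x a\<^sub>x \<delta>\<^sub>x\<close> on the Borel sets of the plane.\<close>

definition diagram_measure :: "diagram \<Rightarrow> (real \<times> real) measure" where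
  "diagram_measure D = distr (density (count_space UNIV) (\<lambda>x. of_nat (D x))) borel (\<lambda>x. x)"

text \<open>The weight is only meaningful on the closed triangle; the indicator discards its other
  values.\<close>

definition weighted_measure ::
  "real \<Rightarrow> (real \<times> real \<Rightarrow> real) \<Rightarrow> diagram \<Rightarrow> (real \<times> real) measure" where
  "weighted_measure L w D =
     density (diagram_measure D) (\<lambda>u. ennreal (indicator (cltri L) u * w u))"

text \<open>The usual \<open>\<sigma>\<close>-algebra of point processes, generated by the counts \<open>D \<mapsto> \<mu>\<^sub>D(A)\<close>.\<close>

definition diagram_space :: "real \<Rightarrow> diagram measure" where
  "diagram_space L = sigma (diagrams L)
     {{D \<in> diagrams L. emeasure (diagram_measure D) A \<in> B} | A B. A \<in> sets borel \<and> B \<in> sets borel}"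


section \<open>The statistical model\<close>

definition holder_class ::
  "real \<Rightarrow> real \<Rightarrow> real \<Rightarrow> (real ^ 'n \<Rightarrow> real \<times> real \<Rightarrow> real) set" where
  "holder_class L s LH = {g. \<forall>z\<in>unit_cube. \<forall>z'\<in>unit_cube. \<forall>u\<in>cltri L. \<forall>u'\<in>cltri L.
     \<bar>g z u - g z' u'\<bar> \<le> LH * (norm (z - z') + norm (u - u')) powr s}"

text \<open>\<open>\<Lambda> z\<close> is a version of the conditional mean measure of the weighted diagram given \<open>Z = z\<close>.\<close>

definition cond_mean_measure ::
  "real \<Rightarrow> (real \<times> real \<Rightarrow> real) \<Rightarrow> ((real ^ 'n) \<times> diagram) measure \<Rightarrow>
    (real ^ 'n \<Rightarrow> (real \<times> real) measure) \<Rightarrow> bool" where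
  "cond_mean_measure L w P \<Lambda> \<longleftrightarrow>
     (\<forall>A\<in>sets borel. A \<subseteq> cltri L \<longrightarrow>
       (AE \<omega> in P. emeasure (\<Lambda> (fst \<omega>)) A =
          nn_cond_exp P (vimage_algebra (space P) fst borel)
            (\<lambda>\<omega>. emeasure (weighted_measure L w (snd \<omega>)) A) \<omega>))"

definition is_cond_intensity ::
  "real \<Rightarrow> (real \<times> real \<Rightarrow> real) \<Rightarrow> ((real ^ 'n) \<times> diagram) measure \<Rightarrow>
    (real ^ 'n \<Rightarrow> real \<times> real \<Rightarrow> real) \<Rightarrow> bool" where
  "is_cond_intensity L w P l \<longleftrightarrow>
     (\<forall>z\<in>unit_cube. \<forall>u\<in>cltri L. 0 \<le> l z u) \<and>
     cond_mean_measure L w P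
       (\<lambda>z. density lborel (\<lambda>u. ennreal (indicator (cltri L) u * l z u)))"

definition P_bm ::
  "real \<Rightarrow> (real \<times> real \<Rightarrow> real) \<Rightarrow> real \<Rightarrow> real \<Rightarrow> real \<Rightarrow> ((real ^ 'n) \<times> diagram) measure set" where
  "P_bm L w s LH Mw = {P.
     prob_space P \<and> sets P = sets (borel \<Otimes>\<^sub>M diagram_space L) \<and>
     distr P borel fst = uniform_measure lborel unit_cube \<and>
     (AE \<omega> in P. emeasure (weighted_measure L w (snd \<omega>)) (cltri L) \<le> ennreal Mw) \<and>
     (\<exists>l \<in> holder_class L s LH. is_cond_intensity L w P l)}"

text \<open>For \<open>P\<close> in the model the choice is unique on \<open>unit_cube \<times> cltri L\<close>, since members of the
  Hoelder class are continuous there.\<close>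

definition cond_intensity ::
  "real \<Rightarrow> (real \<times> real \<Rightarrow> real) \<Rightarrow> real \<Rightarrow> real \<Rightarrow> ((real ^ 'n) \<times> diagram) measure \<Rightarrow>
    real ^ 'n \<Rightarrow> real \<times> real \<Rightarrow> real" where
  "cond_intensity L w s LH P = (SOME l. l \<in> holder_class L s LH \<and> is_cond_intensity L w P l)"


section \<open>The estimator\<close>

definition smoothing_kernel :: "('a::euclidean_space \<Rightarrow> real) \<Rightarrow> bool" where
  "smoothing_kernel K \<longleftrightarrow>
     (\<forall>x. 0 \<le> K x) \<and> bounded (range K) \<and> (\<exists>B. B-lipschitz_on UNIV K) \<and>
     has_bochner_integral lborel K 1 \<and>
     (\<forall>x. K x \<noteq> 0 \<longrightarrow> x \<in> cball 0 1) \<and>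
     (\<exists>c>0. \<exists>r>0. \<forall>x\<in>ball 0 r. c \<le> K x)"

text \<open>With \<open>S\<close> the unit cube and the closed triangle these are \<open>c\<^sub>Z\<close>, \<open>\<kappa>\<^sub>Z\<close> and \<open>c\<^sub>U\<close>, \<open>\<kappa>\<^sub>U\<close>.\<close>

definition scaled_kernel :: "('a::euclidean_space \<Rightarrow> real) \<Rightarrow> real \<Rightarrow> 'a \<Rightarrow> 'a \<Rightarrow> real" where
  "scaled_kernel K h x y = K ((y - x) /\<^sub>R h) / h ^ DIM('a)"

definition boundary_const :: "'a set \<Rightarrow> ('a::euclidean_space \<Rightarrow> real) \<Rightarrow> real \<Rightarrow> 'a \<Rightarrow> real" where
  "boundary_const S K h x = (LINT y:S|lborel. scaled_kernel K h x y)"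

definition corrected_kernel ::
  "'a set \<Rightarrow> ('a::euclidean_space \<Rightarrow> real) \<Rightarrow> real \<Rightarrow> 'a \<Rightarrow> 'a \<Rightarrow> real" where
  "corrected_kernel S K h x y = scaled_kernel K h x y / boundary_const S K h x"

definition smoothed_diagram ::
  "real \<Rightarrow> (real \<times> real \<Rightarrow> real) \<Rightarrow> (real \<times> real \<Rightarrow> real) \<Rightarrow> real \<Rightarrow> diagram \<Rightarrow>
    real \<times> real \<Rightarrow> real" where
  "smoothed_diagram L w KU hU D u =
     (LINT v:cltri L|weighted_measure L w D. corrected_kernel (cltri L) KU hU u v)"

definition intensity_estimator ::
  "real \<Rightarrow> (real \<times> real \<Rightarrow> real) \<Rightarrow> (real ^ 'n \<Rightarrow> real) \<Rightarrow> (real \<times> real \<Rightarrow> real) \<Rightarrow> real \<Rightarrow> real \<Rightarrow>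
    nat \<Rightarrow> (nat \<Rightarrow> (real ^ 'n) \<times> diagram) \<Rightarrow> real ^ 'n \<Rightarrow> real \<times> real \<Rightarrow> real" where
  "intensity_estimator L w KZ KU hZ hU n \<omega> z u =
     (let den = (\<Sum>i<n. corrected_kernel unit_cube KZ hZ z (fst (\<omega> i)))
      in if den = 0 then 0
         else (\<Sum>i<n. corrected_kernel unit_cube KZ hZ z (fst (\<omega> i)) *
                      smoothed_diagram L w KU hU (snd (\<omega> i)) u) / den)"


section \<open>Risk and rates\<close>

text \<open>Valued in \<open>ennreal\<close>, because the real supremum of an unbounded set is unspecified.\<close>

definition sup_norm :: "real \<Rightarrow> (real ^ 'n \<Rightarrow> real \<times> real \<Rightarrow> real) \<Rightarrow> ennreal" where
  "sup_norm L g = (SUP (z, u) \<in> unit_cube \<times> cltri L. ennreal \<bar>g z u\<bar>)"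

text \<open>The \<open>n\<close>-fold product law of an event, taken as an outer measure: it coincides with the
  probability of a measurable event, whereas \<open>emeasure\<close> would silently be \<open>0\<close> on an event that
  fails to be measurable because of samples in a null set.\<close>

definition sample_prob ::
  "'a measure \<Rightarrow> nat \<Rightarrow> ((nat \<Rightarrow> 'a) \<Rightarrow> bool) \<Rightarrow> ennreal" where
  "sample_prob P n Q =
     outer_measure_of (PiM {..<n} (\<lambda>_. P)) {\<omega> \<in> space (PiM {..<n} (\<lambda>_. P)). Q \<omega>}"

definition bandwidth_rate :: "nat \<Rightarrow> real \<Rightarrow> nat \<Rightarrow> real" where
  "bandwidth_rate d s n = (ln (real n) / real n) powr (1 / (2 * s + real d + 2))"

definition risk_rate :: "nat \<Rightarrow> real \<Rightarrow> nat \<Rightarrow> real" where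
  "risk_rate d s n = (ln (real n) / real n) powr (s / (2 * s + real d + 2))"

text \<open>\<open>a \<asymp> b\<close> with explicit proportionality constants \<open>c\<close> and \<open>c'\<close>.\<close>

definition asymp_equiv_consts :: "real \<Rightarrow> real \<Rightarrow> (nat \<Rightarrow> real) \<Rightarrow> (nat \<Rightarrow> real) \<Rightarrow> bool" where
  "asymp_equiv_consts c c' a b \<longleftrightarrow>
     (\<forall>\<^sub>F n in sequentially. c \<le> a n / b n \<and> a n / b n \<le> c')"

end

theory Submission
  imports Defs
begin

text \<open>The estimator is a ratio of two sample means: \<open>num\<close>, the mean of the products of the covariate
  kernel with the smoothed diagrams, and \<open>den\<close>, the mean of the covariate kernel. Since the
  boundary-corrected kernels integrate to one over the compact convex domains
  (\<open>corrected_kernel_controlled\<close>), \<open>den\<close> has mean one, and by the conditional Campbell formula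
  (\<open>campbell\<close>) the mean of \<open>num\<close> is a local average of the intensity. It therefore differs from the
  intensity by at most \<open>LH * (hZ + hU) powr s\<close> (\<open>mean_X\<close>).

  For the random part, a single summand is bounded by a multiple of \<open>1 / (hZ ^ d * hU\<^sup>2)\<close>, with \<open>d\<close>
  the dimension of the covariate, because the total weight of a diagram is bounded; its mean is
  bounded because the intensities of the model are uniformly bounded (\<open>l_le_l_max\<close>). The product of
  the two bounds controls the second moment, and a Bernstein inequality (\<open>mean_deviation\<close>) gives a
  deviation probability \<open>exp (- c * n * \<epsilon>\<^sup>2 * hZ ^ d * hU\<^sup>2)\<close> at one point. Numerator and denominator are
  Lipschitz in \<open>(z, u)\<close> with a constant polynomial in the inverse bandwidths, so it is enough to
  control them on a grid of polynomially many points (\<open>ratio_error\<close>, \<open>finite_sample_bound\<close>).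

  The bandwidth rate \<open>r\<close> balances the two parts: the bias is of order \<open>\<rho> = r powr s\<close>, and for \<open>\<epsilon>\<close>
  a multiple of \<open>\<rho>\<close> the exponent is a multiple of \<open>ln n\<close>. A large multiple beats the grid size and
  the failure probability is of order \<open>1 / n\<close> (\<open>rate_bound\<close>), eventually below any \<open>\<delta>\<close>.\<close>

section \<open>Boundary-corrected kernels\<close>

text \<open>Everything the statistical argument uses about a boundary-corrected kernel. The Lipschitz
  exponent is that of a quotient: the scaled kernel is of order \<open>h ^ -D\<close>, and both it and its
  normalisation have Lipschitz constants of order \<open>h ^ -(D + 1)\<close>.\<close>

definition controlled_kernel ::
  "'a::euclidean_space set \<Rightarrow> real \<Rightarrow> real \<Rightarrow> ('a \<Rightarrow> 'a \<Rightarrow> real) \<Rightarrow> bool" where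
  "controlled_kernel S A h k \<longleftrightarrow> (\<forall>x\<in>S.
     k x \<in> borel_measurable borel \<and>
     (\<forall>y. 0 \<le> k x y \<and> k x y \<le> A / h ^ DIM('a) \<and> (h < dist x y \<longrightarrow> k x y = 0)) \<and>
     (\<integral>\<^sup>+y. ennreal (indicator S y * k x y) \<partial>lborel) = 1 \<and>
     (\<forall>x'\<in>S. \<forall>y. \<bar>k x y - k x' y\<bar> \<le> A / h ^ (2 * DIM('a) + 1) * norm (x - x')))"

text \<open>The normalisation cannot degenerate at the boundary, not even in a corner. By convexity, the
  contraction of the domain towards \<open>x\<close> by a factor proportional to \<open>h\<close> stays in the domain; its
  volume is of order \<open>h ^ D\<close>, and it lies where the scaled kernel is of order \<open>h ^ -D\<close>.\<close>

lemma boundary_const_lower_bound: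
  fixes S :: "'a::euclidean_space set"
  assumes K: "smoothing_kernel K" and S: "compact S" "convex S" "0 < measure lborel S"
  shows "\<exists>c>0. \<forall>h. 0 < h \<and> h \<le> 1 \<longrightarrow> (\<forall>x\<in>S. c \<le> boundary_const S K h x)"
proof -
  obtain c r where c: "c > 0" "r > 0" and low: "\<And>x. x \<in> ball 0 r \<Longrightarrow> c \<le> K x"
    using K unfolding smoothing_kernel_def by blast
  obtain B where "B-lipschitz_on UNIV K" using K unfolding smoothing_kernel_def by blast
  then have contK: "continuous_on UNIV K" by (rule lipschitz_on_continuous_on)
  have Knn: "0 \<le> K x" for x using K unfolding smoothing_kernel_def by blast
  obtain R where R: "R > 0" "\<And>x. x \<in> S \<Longrightarrow> norm x \<le> R"
    using compact_imp_bounded[OF S(1)] bounded_pos by blast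
  define \<tau> where "\<tau> = min 1 (r / (4 * R))"
  have tau: "0 < \<tau>" "\<tau> \<le> 1" "\<tau> * (2 * R) < r"
  proof -
    show "0 < \<tau>" "\<tau> \<le> 1" using c R by (auto simp: \<tau>_def)
    have "\<tau> * (2 * R) \<le> r / (4 * R) * (2 * R)" using R by (intro mult_right_mono) (auto simp: \<tau>_def)
    also have "\<dots> < r" using R c by (simp add: field_simps)
    finally show "\<tau> * (2 * R) < r" .
  qed
  have "c * \<tau> ^ DIM('a) * measure lborel S \<le> boundary_const S K h x"
    if h: "0 < h" "h \<le> 1" and x: "x \<in> S" for h x
  proof -
    define \<theta> where "\<theta> = h * \<tau>"
    have \<theta>: "0 < \<theta>" "\<theta> \<le> 1" using h tau by (auto simp: \<theta>_def mult_le_one)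
    define S' where "S' = (\<lambda>y. \<theta> *\<^sub>R y + (1 - \<theta>) *\<^sub>R x) ` S"
    have S'S: "S' \<subseteq> S" using S(2) x \<theta> unfolding S'_def convex_alt
      by (auto simp: add.commute)
    have compS': "compact S'" unfolding S'_def
      by (intro compact_continuous_image continuous_intros S)
    have mS': "measure lborel S' = \<theta> ^ DIM('a) * measure lborel S"
    proof -
      have "emeasure lebesgue S' = \<bar>\<theta>\<bar> ^ DIM('a) * emeasure lebesgue S"
        unfolding S'_def by (rule emeasure_lebesgue_affine)
      moreover have "S' \<in> sets lborel" "S \<in> sets lborel" using compS' S borel_compact by auto
      ultimately have "emeasure lborel S' = ennreal (\<theta> ^ DIM('a)) * emeasure lborel S"
        using \<theta> by (simp)
      then show ?thesis unfolding measure_def using \<theta> by (simp add: enn2real_mult)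
    qed
    have contk: "continuous_on S (scaled_kernel K h x)"
      unfolding scaled_kernel_def using h
      by (intro continuous_intros continuous_on_compose2[OF contK]) auto
    have int1: "set_integrable lborel S (scaled_kernel K h x)"
      using borel_integrable_compact[OF S(1) contk] by (simp add: set_integrable_def)
    have int2: "integrable lborel (\<lambda>y. indicator S' y *\<^sub>R (c / h ^ DIM('a)))"
      by (rule borel_integrable_compact[OF compS' continuous_on_const])
    have "c * \<tau> ^ DIM('a) * measure lborel S = measure lborel S' * (c / h ^ DIM('a))"
      using h unfolding mS' \<theta>_def by (simp add: power_mult_distrib field_simps)
    also have "\<dots> = (\<integral>y. indicator S' y *\<^sub>R (c / h ^ DIM('a)) \<partial>lborel)"
      by simp
    also have "\<dots> \<le> boundary_const S K h x"
      unfolding boundary_const_def set_lebesgue_integral_def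
    proof (rule integral_mono[OF int2])
      show "integrable lborel (\<lambda>y. indicat_real S y *\<^sub>R scaled_kernel K h x y)"
        using int1 by (simp add: set_integrable_def)
      fix y :: 'a
      show "indicat_real S' y *\<^sub>R (c / h ^ DIM('a)) \<le> indicat_real S y *\<^sub>R scaled_kernel K h x y"
      proof (cases "y \<in> S'")
        case True
        then obtain y0 where y0: "y0 \<in> S" "y = \<theta> *\<^sub>R y0 + (1 - \<theta>) *\<^sub>R x" unfolding S'_def by auto
        have "(y - x) /\<^sub>R h = \<tau> *\<^sub>R (y0 - x)"
          unfolding y0 \<theta>_def using h by (simp add: algebra_simps divide_simps scaleR_right_diff_distrib)
        moreover have "norm (y0 - x) \<le> 2 * R" using norm_triangle_ineq4[of y0 x] R(2)[OF y0(1)] R(2)[OF x] by linarith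
        ultimately have "norm ((y - x) /\<^sub>R h) \<le> \<tau> * (2 * R)" using tau by (simp add: mult_left_mono)
        then have "c \<le> K ((y - x) /\<^sub>R h)" using tau by (intro low) simp
        then show ?thesis using True S'S h by (auto simp: scaled_kernel_def divide_right_mono)
      next
        case False
        then show ?thesis using h Knn by (simp add: scaled_kernel_def)
      qed
    qed
    finally show ?thesis .
  qed
  then show ?thesis using c tau S by (intro exI[of _ "c * \<tau> ^ DIM('a) * measure lborel S"]) auto
qed

lemma corrected_kernel_controlled:
  fixes S :: "'a::euclidean_space set"
  assumes K: "smoothing_kernel K" and S: "compact S" "convex S" "0 < measure lborel S"
  shows "\<exists>A\<ge>1. \<forall>h. 0 < h \<and> h \<le> 1 \<longrightarrow> controlled_kernel S A h (corrected_kernel S K h)"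
proof -
  obtain c where c: "c > 0"
    and low: "\<And>h x. 0 < h \<Longrightarrow> h \<le> 1 \<Longrightarrow> x \<in> S \<Longrightarrow> c \<le> boundary_const S K h x"
    using boundary_const_lower_bound[OF assms] by blast
  obtain B where lipK: "B-lipschitz_on UNIV K" using K unfolding smoothing_kernel_def by blast
  then have B: "0 \<le> B" "\<And>x y. \<bar>K x - K y\<bar> \<le> B * norm (x - y)"
    by (auto simp: lipschitz_on_def dist_norm)
  have contK: "continuous_on UNIV K" using lipK by (rule lipschitz_on_continuous_on)
  then have [measurable]: "K \<in> borel_measurable borel" by (rule borel_measurable_continuous_onI)
  have Knn: "0 \<le> K x" for x using K unfolding smoothing_kernel_def by blast
  have Ksupp: "K x = 0" if "norm x > 1" for x using K that unfolding smoothing_kernel_def by fastforce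
  obtain M where M: "M > 0" "\<And>x. K x \<le> M"
    using K unfolding smoothing_kernel_def bounded_pos by (auto simp: Knn)
  define D where "D = DIM('a)"
  define m where "m = measure lborel S"
  have m: "m > 0" using S by (simp add: m_def)
  define A where "A = 1 + M / c + (B / c + M * (B * m) / (c * c))"
  have A: "1 \<le> A" "M / c \<le> A" "B / c + M * (B * m) / (c * c) \<le> A"
    using M c B m by (auto simp: A_def)
  have "controlled_kernel S A h (corrected_kernel S K h)" if h: "0 < h" "h \<le> 1" for h
  proof -
    let ?k = "corrected_kernel S K h" and ?sk = "scaled_kernel K h" and ?b = "boundary_const S K h"
    have contk: "continuous_on S (?sk x)" for x
      unfolding scaled_kernel_def using h
      by (intro continuous_intros continuous_on_compose2[OF contK]) auto
    have int: "integrable lborel (\<lambda>y. indicator S y *\<^sub>R ?sk x y)" for x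
      using borel_integrable_compact[OF S(1) contk] by simp
    have sknn: "0 \<le> ?sk x y" for x y using Knn h by (simp add: scaled_kernel_def)
    have skM: "?sk x y \<le> M / h ^ D" for x y using M h by (simp add: scaled_kernel_def D_def divide_right_mono)
    have sklip: "\<bar>?sk x y - ?sk x' y\<bar> \<le> B / h ^ (D + 1) * norm (x - x')" for x x' y
    proof -
      have "\<bar>?sk x y - ?sk x' y\<bar> = \<bar>K ((y - x) /\<^sub>R h) - K ((y - x') /\<^sub>R h)\<bar> / h ^ D"
        using h by (simp add: scaled_kernel_def D_def diff_divide_distrib[symmetric])
      also have "\<dots> \<le> (B * norm ((y - x) /\<^sub>R h - (y - x') /\<^sub>R h)) / h ^ D"
        using h by (intro divide_right_mono B) auto
      also have "(y - x) /\<^sub>R h - (y - x') /\<^sub>R h = (x' - x) /\<^sub>R h"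
        by (simp add: algebra_simps)
      also have "norm ((x' - x) /\<^sub>R h) = norm (x - x') / h"
        using h by (simp only: norm_scaleR) (simp add: norm_minus_commute field_simps)
      also have "B * (norm (x - x') / h) / h ^ D = B / h ^ (D + 1) * norm (x - x')"
        by (simp add: field_simps)
      finally show ?thesis .
    qed
    have blip: "\<bar>?b x - ?b x'\<bar> \<le> B / h ^ (D + 1) * norm (x - x') * m" for x x'
    proof -
      have "?b x - ?b x' = (\<integral>y. indicator S y *\<^sub>R (?sk x y - ?sk x' y) \<partial>lborel)"
        unfolding boundary_const_def set_lebesgue_integral_def
        by (subst Bochner_Integration.integral_diff[symmetric]) (use int[of x] int[of x'] in \<open>auto simp: algebra_simps\<close>)
      also have "\<bar>\<dots>\<bar> \<le> (\<integral>y. indicator S y *\<^sub>R (B / h ^ (D + 1) * norm (x - x')) \<partial>lborel)"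
      proof (rule integral_abs_bound[THEN order_trans], rule integral_mono)
        have "integrable lborel (\<lambda>y. indicator S y *\<^sub>R (?sk x y - ?sk x' y))"
          using Bochner_Integration.integrable_diff[OF int[of x] int[of x']] by (simp add: algebra_simps)
        then show "integrable lborel (\<lambda>y. \<bar>indicator S y *\<^sub>R (?sk x y - ?sk x' y)\<bar>)" by (rule integrable_abs)
        show "integrable lborel (\<lambda>y. indicat_real S y *\<^sub>R (B / h ^ (D + 1) * norm (x - x')))"
          by (rule borel_integrable_compact[OF S(1) continuous_on_const])
      qed (use sklip in \<open>auto simp: indicator_def\<close>)
      also have "\<dots> = B / h ^ (D + 1) * norm (x - x') * m" by (simp add: m_def)
      finally show ?thesis .
    qed
    have bpos: "c \<le> ?b x" "0 < ?b x" if "x \<in> S" for x using low[OF h that] c by auto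
    have meas: "?k x \<in> borel_measurable borel" for x
      unfolding corrected_kernel_def scaled_kernel_def by measurable
    show ?thesis unfolding controlled_kernel_def D_def[symmetric]
    proof (intro ballI conjI allI)
      fix x assume x: "x \<in> S"
      show "?k x \<in> borel_measurable borel" by (rule meas)
      show knn: "0 \<le> ?k x y" for y using sknn bpos[OF x] by (simp add: corrected_kernel_def)
      show "?k x y \<le> A / h ^ D" for y
      proof -
        have "?k x y \<le> (M / h ^ D) / c" unfolding corrected_kernel_def
          using skM sknn bpos[OF x] c M h by (intro frac_le) auto
        also have "\<dots> = (M / c) / h ^ D" by simp
        also have "\<dots> \<le> A / h ^ D" using A h by (intro divide_right_mono) auto
        finally show ?thesis .
      qed
      show "h < dist x y \<longrightarrow> ?k x y = 0" for y
      proof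
        assume "h < dist x y"
        then have "norm ((y - x) /\<^sub>R h) > 1" using h by (simp only: norm_scaleR) (simp add: dist_norm norm_minus_commute field_simps)
        then show "?k x y = 0" using Ksupp by (simp add: corrected_kernel_def scaled_kernel_def)
      qed
      have "integrable lborel (\<lambda>y. indicator S y * ?k x y)"
        using integrable_divide_zero[of "?b x" lborel, OF int[of x]] by (simp add: corrected_kernel_def)
      then have "(\<integral>\<^sup>+y. ennreal (indicator S y * ?k x y) \<partial>lborel) =
          ennreal (\<integral>y. indicator S y * ?k x y \<partial>lborel)"
        using knn by (intro nn_integral_eq_integral) auto
      also have "(\<integral>y. indicator S y * ?k x y \<partial>lborel) = (\<integral>y. indicator S y *\<^sub>R ?sk x y / ?b x \<partial>lborel)"
        by (simp add: corrected_kernel_def)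
      also have "\<dots> = 1" using bpos[OF x]
        by (subst integral_divide_zero) (auto simp: boundary_const_def set_lebesgue_integral_def)
      finally show "(\<integral>\<^sup>+y. ennreal (indicator S y * ?k x y) \<partial>lborel) = 1" by simp
      fix x' y assume x': "x' \<in> S"
      have eq: "?k x y - ?k x' y = (?sk x y - ?sk x' y) / ?b x + ?sk x' y * (?b x' - ?b x) / (?b x * ?b x')"
        using bpos[OF x] bpos[OF x'] by (simp add: corrected_kernel_def field_simps)
      have "\<bar>?k x y - ?k x' y\<bar> \<le> \<bar>?sk x y - ?sk x' y\<bar> / ?b x + ?sk x' y * \<bar>?b x' - ?b x\<bar> / (?b x * ?b x')"
        unfolding eq using bpos[OF x] bpos[OF x'] sknn[of x' y]
        by (intro order_trans[OF abs_triangle_ineq]) (simp add: abs_mult)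
      also have "\<dots> \<le> (B / h ^ (D + 1) * norm (x - x')) / c
          + (M / h ^ D) * (B / h ^ (D + 1) * norm (x - x') * m) / (c * c)"
        using bpos[OF x] bpos[OF x'] sknn[of x' y] skM[of x' y] sklip[of x y x'] blip[of x' x] c B M m h
        by (intro add_mono frac_le mult_mono mult_nonneg_nonneg) (auto simp: norm_minus_commute)
      also have "\<dots> = (B / c) / h ^ (D + 1) * norm (x - x')
          + (M * (B * m) / (c * c)) / h ^ (2 * D + 1) * norm (x - x')"
      proof -
        have "h ^ (2 * D + 1) = h ^ D * h ^ (D + 1)" by (simp add: power_add mult_2)
        then show ?thesis unfolding \<open>h ^ (2 * D + 1) = _\<close> by (simp add: field_simps)
      qed
      also have "\<dots> \<le> (B / c) / h ^ (2 * D + 1) * norm (x - x')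
          + (M * (B * m) / (c * c)) / h ^ (2 * D + 1) * norm (x - x')"
        using h c B by (intro add_right_mono mult_right_mono divide_left_mono power_decreasing) auto
      also have "\<dots> = (B / c + M * (B * m) / (c * c)) / h ^ (2 * D + 1) * norm (x - x')"
        by (simp only: add_divide_distrib distrib_right)
      also have "\<dots> \<le> A / h ^ (2 * D + 1) * norm (x - x')"
        using A h by (intro mult_right_mono divide_right_mono) auto
      finally show "\<bar>?k x y - ?k x' y\<bar> \<le> A / h ^ (2 * D + 1) * norm (x - x')" .
    qed
  qed
  then show ?thesis using A by blast
qed

lemma controlled_kernel_mono:
  assumes "controlled_kernel S A h k" "A \<le> A'" "0 < h"
  shows "controlled_kernel S A' h k"
proof -
  have le: "A / h ^ m \<le> A' / h ^ m" for m using assms by (intro divide_right_mono) auto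
  show ?thesis
    using assms(1) unfolding controlled_kernel_def
    by (blast intro: order_trans[OF _ le] order_trans[OF _ mult_right_mono[OF le norm_ge_zero]])
qed

section \<open>Weighted diagram measures and the Campbell formula\<close>

lemma sets_diagram_measure [simp, measurable_cong]: "sets (diagram_measure D) = sets borel"
  by (simp add: diagram_measure_def)

lemma space_diagram_measure [simp]: "space (diagram_measure D) = UNIV"
  by (simp add: diagram_measure_def)

lemma sets_weighted_measure [simp, measurable_cong]: "sets (weighted_measure L w D) = sets borel"
  by (simp add: weighted_measure_def)

lemma space_weighted_measure [simp]: "space (weighted_measure L w D) = UNIV"
  by (simp add: weighted_measure_def)

lemma space_diagram_space: "space (diagram_space L) = diagrams L"
  unfolding diagram_space_def by (rule space_measure_of) auto

lemma measurable_emeasure_diagram_measure: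
  assumes "A \<in> sets borel"
  shows "(\<lambda>D. emeasure (diagram_measure D) A) \<in> borel_measurable (diagram_space L)"
proof (rule measurableI)
  fix B :: "ennreal set" assume "B \<in> sets borel"
  then have "{D \<in> diagrams L. emeasure (diagram_measure D) A \<in> B} \<in> sets (diagram_space L)"
    unfolding diagram_space_def using assms by (intro in_measure_of) auto
  also have "{D \<in> diagrams L. emeasure (diagram_measure D) A \<in> B} =
      (\<lambda>D. emeasure (diagram_measure D) A) -` B \<inter> space (diagram_space L)"
    by (auto simp: space_diagram_space)
  finally show "(\<lambda>D. emeasure (diagram_measure D) A) -` B \<inter> space (diagram_space L)
      \<in> sets (diagram_space L)" .
qed auto

lemma measurable_nn_integral_diagram_measure:
  assumes "f \<in> borel_measurable borel"
  shows "(\<lambda>D. \<integral>\<^sup>+v. f v \<partial>diagram_measure D) \<in> borel_measurable (diagram_space L)"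
  using assms
proof (induction f rule: borel_measurable_induct)
  case (cong f g)
  then show ?case by (simp cong: nn_integral_cong)
next
  case (set A)
  then show ?case using measurable_emeasure_diagram_measure[of A L] by simp
next
  case (mult u c)
  then show ?case by (simp add: nn_integral_cmult)
next
  case (add u v)
  then show ?case by (simp add: nn_integral_add)
next
  case (seq U)
  then have "(\<integral>\<^sup>+v. (SUP i. U i) v \<partial>diagram_measure D) = (SUP i. \<integral>\<^sup>+v. U i v \<partial>diagram_measure D)" for D
    by (simp add: nn_integral_monotone_convergence_SUP image_image)
  then show ?case using seq by simp
qed

locale diagram_weight =
  fixes L :: real and w :: "real \<times> real \<Rightarrow> real"
  assumes w_cont: "continuous_on (cltri L) w"
begin

lemma cltri_eq: "cltri L = {u. 0 \<le> fst u} \<inter> {u. fst u \<le> snd u} \<inter> {u. snd u \<le> L}"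
  by (auto simp: cltri_def)

lemma closed_cltri: "closed (cltri L)"
  unfolding cltri_eq by (intro closed_Int closed_Collect_le continuous_intros)

lemma measurable_cltri [measurable]: "cltri L \<in> sets borel"
  using closed_cltri by (rule borel_closed)

lemma measurable_w [measurable]: "(\<lambda>u. indicator (cltri L) u * w u) \<in> borel_measurable borel"
  using borel_measurable_continuous_on_indicator[OF measurable_cltri w_cont] by simp

lemma nn_integral_weighted_measure:
  assumes [measurable]: "f \<in> borel_measurable borel"
  shows "(\<integral>\<^sup>+v. f v \<partial>weighted_measure L w D) =
    (\<integral>\<^sup>+v. ennreal (indicator (cltri L) v * w v) * f v \<partial>diagram_measure D)"
  unfolding weighted_measure_def by (subst nn_integral_density) auto

lemma measurable_nn_integral_weighted_measure:
  assumes [measurable]: "f \<in> borel_measurable borel"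
  shows "(\<lambda>D. \<integral>\<^sup>+v. f v \<partial>weighted_measure L w D) \<in> borel_measurable (diagram_space L)"
  unfolding nn_integral_weighted_measure[OF assms]
  by (rule measurable_nn_integral_diagram_measure) measurable

lemma measurable_emeasure_weighted_measure:
  assumes "A \<in> sets borel"
  shows "(\<lambda>D. emeasure (weighted_measure L w D) A) \<in> borel_measurable (diagram_space L)"
  using measurable_nn_integral_weighted_measure[of "indicator A"] assms by simp

lemma nn_integral_weighted_measure_cltri:
  assumes [measurable]: "f \<in> borel_measurable borel"
  shows "(\<integral>\<^sup>+v. indicator (cltri L) v * f v \<partial>weighted_measure L w D) = (\<integral>\<^sup>+v. f v \<partial>weighted_measure L w D)"
  by (subst (1 2) nn_integral_weighted_measure)
     (auto intro!: nn_integral_cong simp: indicator_def)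

lemma emeasure_weighted_measure_cltri:
  assumes [measurable]: "A \<in> sets borel"
  shows "emeasure (weighted_measure L w D) (A \<inter> cltri L) = emeasure (weighted_measure L w D) A"
  using nn_integral_weighted_measure_cltri[of "indicator A" D] nn_integral_indicator[of "A \<inter> cltri L" "weighted_measure L w D"]
  by (simp add: indicator_inter_arith[symmetric] Int_commute)

end

lemma unit_cube_measurable [measurable]: "unit_cube \<in> sets borel"
  by (simp add: unit_cube_def)

lemma emeasure_unit_cube: "emeasure lborel (unit_cube :: (real^'n) set) = 1"
proof -
  have "(\<Prod>b\<in>Basis. (1 - 0 :: real^'n) \<bullet> b) = 1"
    by (intro prod.neutral) (auto simp: Basis_vec_def inner_axis)
  moreover have "(0 :: real^'n) \<bullet> b \<le> 1 \<bullet> b" if "b \<in> Basis" for b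
    using that by (auto simp: Basis_vec_def inner_axis)
  ultimately show ?thesis
    unfolding unit_cube_def by (subst emeasure_lborel_cbox) simp_all
qed

lemma nn_integral_uniform_cube:
  assumes P: "distr P borel fst = uniform_measure lborel (unit_cube :: (real^'n) set)"
    and fst: "fst \<in> P \<rightarrow>\<^sub>M borel" and [measurable]: "g \<in> borel_measurable borel"
  shows "(\<integral>\<^sup>+\<omega>. g (fst \<omega>) \<partial>P) = (\<integral>\<^sup>+z. indicator unit_cube z * g z \<partial>lborel)"
proof -
  have "(\<integral>\<^sup>+\<omega>. g (fst \<omega>) \<partial>P) = (\<integral>\<^sup>+z. g z \<partial>distr P borel fst)"
    using fst by (subst nn_integral_distr) auto
  also have "\<dots> = (\<integral>\<^sup>+z. indicator unit_cube z * g z \<partial>lborel)"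
    unfolding P by (subst nn_integral_uniform_measure) (auto simp: emeasure_unit_cube mult.commute divide_ennreal_def)
  finally show ?thesis .
qed

locale bm_law = diagram_weight L w for L w +
  fixes P :: "((real ^ 'n) \<times> diagram) measure" and s LH Mw :: real
    and l :: "real ^ 'n \<Rightarrow> real \<times> real \<Rightarrow> real"
  assumes L_pos: "0 < L" and s_pos: "0 < s" and LH_pos: "0 < LH" and Mw_pos: "0 < Mw"
    and prob: "prob_space P" and sets_P: "sets P = sets (borel \<Otimes>\<^sub>M diagram_space L)"
    and uniform: "distr P borel fst = uniform_measure lborel unit_cube"
    and mass: "AE \<omega> in P. emeasure (weighted_measure L w (snd \<omega>)) (cltri L) \<le> ennreal Mw"
    and holder: "l \<in> holder_class L s LH" and intensity: "is_cond_intensity L w P l"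
begin

sublocale prob_space P by (rule prob)

declare sets_P [measurable_cong]

lemma l_holder:
  "z \<in> unit_cube \<Longrightarrow> z' \<in> unit_cube \<Longrightarrow> u \<in> cltri L \<Longrightarrow> u' \<in> cltri L \<Longrightarrow>
    \<bar>l z u - l z' u'\<bar> \<le> LH * (norm (z - z') + norm (u - u')) powr s"
  using holder unfolding holder_class_def by blast

lemma l_nonneg: "z \<in> unit_cube \<Longrightarrow> u \<in> cltri L \<Longrightarrow> 0 \<le> l z u"
  using intensity unfolding is_cond_intensity_def by blast

text \<open>Only on \<open>unit_cube \<times> cltri L\<close> is \<open>l\<close> known to be continuous; its extension by zero is Borel on the
  whole space.\<close>

definition l_ext :: "real ^ 'n \<Rightarrow> real \<times> real \<Rightarrow> real" where
  "l_ext z u = indicator (unit_cube \<times> cltri L) (z, u) * l z u"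

lemma l_ext_eq: "z \<in> unit_cube \<Longrightarrow> l_ext z u = indicator (cltri L) u * l z u"
  by (auto simp: l_ext_def indicator_def)

lemma continuous_on_l: "continuous_on (unit_cube \<times> cltri L) (\<lambda>p. l (fst p) (snd p))"
  unfolding continuous_on_def
proof
  fix p :: "(real ^ 'n) \<times> (real \<times> real)" assume p: "p \<in> unit_cube \<times> cltri L"
  let ?F = "at p within unit_cube \<times> cltri L"
  let ?g = "\<lambda>q. norm (fst q - fst p) + norm (snd q - snd p)"
  have "(?g \<longlongrightarrow> norm (fst p - fst p) + norm (snd p - snd p)) ?F"
    by (intro tendsto_intros)
  then have "((\<lambda>q. ?g q powr s) \<longlongrightarrow> 0 powr s) ?F"
    using s_pos by (intro tendsto_powr' tendsto_const) auto
  then have "((\<lambda>q. LH * ?g q powr s) \<longlongrightarrow> 0) ?F"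
    using s_pos by (auto intro!: tendsto_eq_intros)
  moreover have "\<forall>\<^sub>F q in ?F. norm (l (fst q) (snd q) - l (fst p) (snd p)) \<le> LH * ?g q powr s"
    unfolding eventually_at_filter using p by (intro always_eventually) (auto intro!: l_holder)
  ultimately have "((\<lambda>q. l (fst q) (snd q) - l (fst p) (snd p)) \<longlongrightarrow> 0) ?F"
    by (rule Lim_null_comparison[rotated])
  then show "((\<lambda>q. l (fst q) (snd q)) \<longlongrightarrow> l (fst p) (snd p)) ?F"
    by (rule LIM_zero_cancel)
qed

lemma measurable_l_ext [measurable]:
  assumes [measurable]: "f \<in> N \<rightarrow>\<^sub>M borel" "g \<in> N \<rightarrow>\<^sub>M borel"
  shows "(\<lambda>x. l_ext (f x) (g x)) \<in> borel_measurable N"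
proof -
  have "(unit_cube \<times> cltri L :: ((real^'n) \<times> (real \<times> real)) set) \<in> sets borel"
    using unit_cube_measurable measurable_cltri by (rule borel_Times)
  from borel_measurable_continuous_on_indicator[OF this continuous_on_l]
  have [measurable]: "(\<lambda>p. l_ext (fst p) (snd p)) \<in> borel_measurable borel" by (simp add: l_ext_def)
  have "(\<lambda>x. (f x, g x)) \<in> N \<rightarrow>\<^sub>M borel" by (rule borel_measurable_Pair) fact+
  from measurable_compose[OF this, of "\<lambda>p. l_ext (fst p) (snd p)"] show ?thesis by simp
qed

lemma fst_measurable [measurable]: "fst \<in> P \<rightarrow>\<^sub>M borel"
  using measurable_fst by (simp add: measurable_cong_sets[OF sets_P refl])

lemma snd_measurable [measurable]: "snd \<in> P \<rightarrow>\<^sub>M diagram_space L"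
  using measurable_snd by (simp add: measurable_cong_sets[OF sets_P refl])

lemma AE_fst: "AE \<omega> in P. fst \<omega> \<in> unit_cube"
proof -
  have "AE z in uniform_measure lborel unit_cube. z \<in> (unit_cube :: (real^'n) set)"
    by (rule AE_uniform_measureI) auto
  then have "AE z in distr P borel fst. z \<in> unit_cube" unfolding uniform .
  then show ?thesis by (rule AE_distrD[rotated]) simp
qed

text \<open>The defining property of the conditional expectation, tested against a function of \<open>fst\<close>. The
  conditional mean measure is prescribed only on subsets of \<open>cltri L\<close>, which suffices because the
  weighted measure lives there.\<close>

lemma campbell_indicator:
  assumes [measurable]: "g \<in> borel_measurable borel" and A [measurable]: "A \<in> sets borel"
  shows "(\<integral>\<^sup>+\<omega>. g (fst \<omega>) * emeasure (weighted_measure L w (snd \<omega>)) A \<partial>P) =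
    (\<integral>\<^sup>+\<omega>. g (fst \<omega>) * (\<integral>\<^sup>+v. indicator A v * ennreal (l_ext (fst \<omega>) v) \<partial>lborel) \<partial>P)"
proof -
  let ?F = "vimage_algebra (space P) fst (borel :: (real^'n) measure)"
  have "subalgebra P ?F"
    unfolding subalgebra_def by (auto simp: sets_vimage_algebra2)
  then interpret finite_measure_subalgebra P ?F by unfold_locales
  have [measurable]: "(\<lambda>\<omega>. emeasure (weighted_measure L w (snd \<omega>)) B) \<in> borel_measurable P"
    if "B \<in> sets borel" for B
    using measurable_compose[OF snd_measurable measurable_emeasure_weighted_measure[OF that]] .
  have gF: "(\<lambda>\<omega>. g (fst \<omega>)) \<in> borel_measurable ?F"
    by (rule measurable_compose[OF measurable_vimage_algebra1]) auto
  have "(\<integral>\<^sup>+\<omega>. g (fst \<omega>) * emeasure (weighted_measure L w (snd \<omega>)) A \<partial>P) =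
      (\<integral>\<^sup>+\<omega>. g (fst \<omega>) * emeasure (weighted_measure L w (snd \<omega>)) (A \<inter> cltri L) \<partial>P)"
    by (simp add: emeasure_weighted_measure_cltri)
  also have "\<dots> = (\<integral>\<^sup>+\<omega>. g (fst \<omega>) * nn_cond_exp P ?F (\<lambda>\<omega>. emeasure (weighted_measure L w (snd \<omega>)) (A \<inter> cltri L)) \<omega> \<partial>P)"
    by (rule nn_cond_exp_intg[symmetric, OF gF]) measurable
  also have "\<dots> = (\<integral>\<^sup>+\<omega>. g (fst \<omega>) * (\<integral>\<^sup>+v. indicator A v * ennreal (l_ext (fst \<omega>) v) \<partial>lborel) \<partial>P)"
  proof (rule nn_integral_cong_AE)
    have "AE \<omega> in P. emeasure (density lborel (\<lambda>u. ennreal (indicator (cltri L) u * l (fst \<omega>) u))) (A \<inter> cltri L) =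
        nn_cond_exp P ?F (\<lambda>\<omega>. emeasure (weighted_measure L w (snd \<omega>)) (A \<inter> cltri L)) \<omega>"
      using intensity unfolding is_cond_intensity_def cond_mean_measure_def by auto
    with AE_fst
    show "AE \<omega> in P. g (fst \<omega>) * nn_cond_exp P ?F (\<lambda>\<omega>. emeasure (weighted_measure L w (snd \<omega>)) (A \<inter> cltri L)) \<omega>
        = g (fst \<omega>) * (\<integral>\<^sup>+v. indicator A v * ennreal (l_ext (fst \<omega>) v) \<partial>lborel)"
    proof eventually_elim
      case (elim \<omega>)
      have "emeasure (density lborel (\<lambda>u. ennreal (l_ext (fst \<omega>) u))) (A \<inter> cltri L)
          = (\<integral>\<^sup>+v. ennreal (l_ext (fst \<omega>) v) * indicator (A \<inter> cltri L) v \<partial>lborel)"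
        by (subst emeasure_density) auto
      also have "\<dots> = (\<integral>\<^sup>+v. indicator A v * ennreal (l_ext (fst \<omega>) v) \<partial>lborel)"
        by (intro nn_integral_cong) (auto simp: l_ext_def indicator_def)
      finally show ?case using elim by (simp add: l_ext_eq)
    qed
  qed
  finally show ?thesis .
qed

lemma campbell_nn_integral:
  assumes [measurable]: "g \<in> borel_measurable borel" and "f \<in> borel_measurable borel"
  shows "(\<integral>\<^sup>+\<omega>. g (fst \<omega>) * (\<integral>\<^sup>+v. f v \<partial>weighted_measure L w (snd \<omega>)) \<partial>P) =
    (\<integral>\<^sup>+\<omega>. g (fst \<omega>) * (\<integral>\<^sup>+v. f v * ennreal (l_ext (fst \<omega>) v) \<partial>lborel) \<partial>P)"
  using assms(2)
proof (induction f rule: borel_measurable_induct)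
  case (cong f h)
  then show ?case by (simp cong: nn_integral_cong)
next
  case (set A)
  then show ?case using campbell_indicator[of g A] by simp
next
  case (mult u c)
  have [measurable]: "(\<lambda>\<omega>. \<integral>\<^sup>+v. u v \<partial>weighted_measure L w (snd \<omega>)) \<in> borel_measurable P"
    using measurable_compose[OF snd_measurable measurable_nn_integral_weighted_measure] mult by blast
  note mult.hyps(2)[measurable]
  have "(\<integral>\<^sup>+\<omega>. g (fst \<omega>) * (c * (\<integral>\<^sup>+v. u v \<partial>weighted_measure L w (snd \<omega>))) \<partial>P) =
      c * (\<integral>\<^sup>+\<omega>. g (fst \<omega>) * (\<integral>\<^sup>+v. u v \<partial>weighted_measure L w (snd \<omega>)) \<partial>P)"
    by (subst nn_integral_cmult[symmetric]) (auto simp: mult_ac)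
  also have "\<dots> = (\<integral>\<^sup>+\<omega>. g (fst \<omega>) * (c * (\<integral>\<^sup>+v. u v * ennreal (l_ext (fst \<omega>) v) \<partial>lborel)) \<partial>P)"
    unfolding mult.IH by (subst nn_integral_cmult[symmetric]) (auto simp: mult_ac)
  finally show ?case
    by (simp add: nn_integral_cmult mult.assoc)
next
  case (add u v)
  note add.hyps(1,3)[measurable]
  have [measurable]: "(\<lambda>\<omega>. \<integral>\<^sup>+v. f v \<partial>weighted_measure L w (snd \<omega>)) \<in> borel_measurable P"
    if "f \<in> borel_measurable borel" for f
    using measurable_compose[OF snd_measurable measurable_nn_integral_weighted_measure[OF that]] .
  show ?case
    by (simp add: nn_integral_add distrib_left distrib_right add.IH)
next
  case (seq U)
  note seq.hyps(1)[measurable]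
  have [measurable]: "(\<lambda>\<omega>. \<integral>\<^sup>+v. f v \<partial>weighted_measure L w (snd \<omega>)) \<in> borel_measurable P"
    if "f \<in> borel_measurable borel" for f
    using measurable_compose[OF snd_measurable measurable_nn_integral_weighted_measure[OF that]] .
  have mono: "mono U" using seq.hyps by (simp add: incseq_def mono_def)
  have 1: "(\<integral>\<^sup>+v. (SUP i. U i) v \<partial>weighted_measure L w D) = (SUP i. \<integral>\<^sup>+v. U i v \<partial>weighted_measure L w D)" for D
    using mono by (simp add: nn_integral_monotone_convergence_SUP image_image)
  have 2: "(\<integral>\<^sup>+v. (SUP i. U i) v * ennreal (l_ext z v) \<partial>lborel) = (SUP i. \<integral>\<^sup>+v. U i v * ennreal (l_ext z v) \<partial>lborel)" for z
    using mono unfolding SUP_apply SUP_mult_right_ennreal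
    by (subst nn_integral_monotone_convergence_SUP[symmetric])
       (auto simp: mono_def le_fun_def image_image intro!: mult_right_mono)
  have "(\<integral>\<^sup>+\<omega>. g (fst \<omega>) * (SUP i. \<integral>\<^sup>+v. U i v \<partial>weighted_measure L w (snd \<omega>)) \<partial>P) =
      (SUP i. \<integral>\<^sup>+\<omega>. g (fst \<omega>) * (\<integral>\<^sup>+v. U i v \<partial>weighted_measure L w (snd \<omega>)) \<partial>P)"
    using mono unfolding SUP_mult_left_ennreal
    by (subst nn_integral_monotone_convergence_SUP[symmetric])
       (auto simp: mono_def le_fun_def intro!: mult_left_mono nn_integral_mono)
  also have "\<dots> = (SUP i. \<integral>\<^sup>+\<omega>. g (fst \<omega>) * (\<integral>\<^sup>+v. U i v * ennreal (l_ext (fst \<omega>) v) \<partial>lborel) \<partial>P)"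
    by (simp add: seq.IH)
  also have "\<dots> = (\<integral>\<^sup>+\<omega>. g (fst \<omega>) * (SUP i. \<integral>\<^sup>+v. U i v * ennreal (l_ext (fst \<omega>) v) \<partial>lborel) \<partial>P)"
    using mono unfolding SUP_mult_left_ennreal
    by (subst nn_integral_monotone_convergence_SUP[symmetric])
       (auto simp: mono_def le_fun_def intro!: mult_left_mono mult_right_mono nn_integral_mono)
  finally show ?case unfolding 1 2 .
qed

text \<open>A conditional Campbell formula: it turns the means of the smoothed observations into kernel
  averages of \<open>l\<close>.\<close>

lemma campbell:
  assumes [measurable]: "g \<in> borel_measurable borel" "f \<in> borel_measurable borel"
  shows "(\<integral>\<^sup>+\<omega>. g (fst \<omega>) * (\<integral>\<^sup>+v. f v \<partial>weighted_measure L w (snd \<omega>)) \<partial>P) =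
    (\<integral>\<^sup>+z. indicator unit_cube z * (g z * (\<integral>\<^sup>+v. indicator (cltri L) v * (f v * ennreal (l z v)) \<partial>lborel)) \<partial>lborel)"
proof -
  have "(\<integral>\<^sup>+z. indicator unit_cube z * (g z * (\<integral>\<^sup>+v. f v * ennreal (l_ext z v) \<partial>lborel)) \<partial>lborel) =
    (\<integral>\<^sup>+z. indicator unit_cube z * (g z * (\<integral>\<^sup>+v. indicator (cltri L) v * (f v * ennreal (l z v)) \<partial>lborel)) \<partial>lborel)"
  proof (intro nn_integral_cong)
    fix z :: "real ^ 'n"
    have "f v * ennreal (l_ext z v) = indicator (cltri L) v * (f v * ennreal (l z v))" if "z \<in> unit_cube" for v
      using that by (auto simp: l_ext_eq indicator_def)
    then show "indicator unit_cube z * (g z * (\<integral>\<^sup>+v. f v * ennreal (l_ext z v) \<partial>lborel)) =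
        indicator unit_cube z * (g z * (\<integral>\<^sup>+v. indicator (cltri L) v * (f v * ennreal (l z v)) \<partial>lborel))"
      by (cases "z \<in> unit_cube") auto
  qed
  then show ?thesis
    unfolding campbell_nn_integral[OF assms]
    by (subst nn_integral_uniform_cube[OF uniform]) auto
qed

lemma mean_mass:
  "(\<integral>\<^sup>+z. indicator unit_cube z * (\<integral>\<^sup>+v. indicator (cltri L) v * ennreal (l z v) \<partial>lborel) \<partial>lborel) \<le> ennreal Mw"
proof -
  have "(\<integral>\<^sup>+\<omega>. 1 * (\<integral>\<^sup>+v. 1 \<partial>weighted_measure L w (snd \<omega>)) \<partial>P) \<le> (\<integral>\<^sup>+\<omega>. ennreal Mw \<partial>P)"
  proof (rule nn_integral_mono_AE, use mass in eventually_elim)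
    case (elim \<omega>)
    then show ?case
      using emeasure_weighted_measure_cltri[of UNIV "snd \<omega>"] by simp
  qed
  also have "\<dots> = ennreal Mw" by (simp add: emeasure_space_1)
  finally show ?thesis using campbell[of "\<lambda>_. 1" "\<lambda>_. 1"] by simp
qed

end

section \<open>Concentration of sample means\<close>

lemma exp_le_quadratic:
  assumes "(x::real) \<le> 1" shows "exp x \<le> 1 + x + x\<^sup>2"
proof (cases "x \<ge> 0")
  case True then show ?thesis using assms exp_bound by blast
next
  case False
  define y where "y = -x"
  have y: "y > 0" using False by (simp add: y_def)
  have "1 \<le> (1 - y + y\<^sup>2) * (1 + y)" using y by (simp add: power2_eq_square algebra_simps)
  also have "\<dots> \<le> (1 - y + y\<^sup>2) * exp y"
  proof (rule mult_left_mono)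
    have "0 \<le> (y - 1/2)\<^sup>2 + 3/4" by simp
    then show "0 \<le> 1 - y + y\<^sup>2" by (simp add: power2_eq_square algebra_simps)
  qed simp
  finally show ?thesis by (simp add: y_def exp_minus field_simps)
qed

text \<open>Bernstein's argument. A Hoeffding bound would only see the range \<open>b\<close> of the summands and lose
  the rate; the quadratic bound for \<open>exp\<close> brings in the second moment.\<close>

lemma (in prob_space) exp_moment_bound:
  fixes f :: "'a \<Rightarrow> real"
  assumes f [measurable]: "f \<in> borel_measurable M" and bound: "AE x in M. \<bar>f x\<bar> \<le> b"
    and var: "expectation (\<lambda>x. (f x)\<^sup>2) \<le> V" and t: "\<bar>t\<bar> * b \<le> 1"
  shows "(\<integral>\<^sup>+x. ennreal (exp (t * (f x - expectation f))) \<partial>M) \<le> ennreal (exp (t\<^sup>2 * V))"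
proof -
  let ?m = "expectation f"
  have intf: "integrable M f" by (rule integrable_const_bound[of _ b]) (use bound in auto)
  have intf2: "integrable M (\<lambda>x. (f x)\<^sup>2)"
  proof (rule integrable_const_bound[of _ "b\<^sup>2"])
    show "AE x in M. norm ((f x)\<^sup>2) \<le> b\<^sup>2" using bound
    proof eventually_elim
      case (elim x)
      then have "\<bar>f x\<bar>\<^sup>2 \<le> b\<^sup>2" by (intro power_mono) auto
      then show ?case by simp
    qed
  qed simp
  have le: "AE x in M. exp (t * f x) \<le> 1 + t * f x + t\<^sup>2 * (f x)\<^sup>2" using bound
  proof eventually_elim
    case (elim x)
    have "t * f x \<le> \<bar>t\<bar> * \<bar>f x\<bar>" by (metis abs_ge_self abs_mult)
    also have "\<dots> \<le> \<bar>t\<bar> * b" using elim by (intro mult_left_mono) auto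
    finally have "t * f x \<le> 1" using t by simp
    from exp_le_quadratic[OF this] show ?case by (simp add: power_mult_distrib)
  qed
  have "(\<integral>\<^sup>+x. ennreal (exp (t * (f x - ?m))) \<partial>M) =
      (\<integral>\<^sup>+x. ennreal (exp (- t * ?m)) * ennreal (exp (t * f x)) \<partial>M)"
    by (intro nn_integral_cong) (simp add: ennreal_mult[symmetric] exp_add[symmetric] algebra_simps)
  also have "\<dots> = ennreal (exp (- t * ?m)) * (\<integral>\<^sup>+x. ennreal (exp (t * f x)) \<partial>M)"
    by (subst nn_integral_cmult) auto
  also have "(\<integral>\<^sup>+x. ennreal (exp (t * f x)) \<partial>M) \<le> (\<integral>\<^sup>+x. ennreal (1 + t * f x + t\<^sup>2 * (f x)\<^sup>2) \<partial>M)"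
    by (intro nn_integral_mono_AE) (use le in eventually_elim, simp add: ennreal_leI)
  also have "\<dots> = ennreal (expectation (\<lambda>x. 1 + t * f x + t\<^sup>2 * (f x)\<^sup>2))"
  proof (rule nn_integral_eq_integral)
    show "integrable M (\<lambda>x. 1 + t * f x + t\<^sup>2 * (f x)\<^sup>2)" using intf intf2 by simp
    show "AE x in M. 0 \<le> 1 + t * f x + t\<^sup>2 * (f x)\<^sup>2" using le
    proof eventually_elim
      case (elim x)
      show ?case by (rule order_trans[OF _ elim]) simp
    qed
  qed
  also have "expectation (\<lambda>x. 1 + t * f x + t\<^sup>2 * (f x)\<^sup>2) = 1 + t * ?m + t\<^sup>2 * expectation (\<lambda>x. (f x)\<^sup>2)"
    using intf intf2 by (simp add: prob_space)
  also have "\<dots> \<le> 1 + (t * ?m + t\<^sup>2 * V)" using var by (simp add: mult_left_mono)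
  also have "\<dots> \<le> exp (t * ?m + t\<^sup>2 * V)" by (rule exp_ge_add_one_self)
  also have "ennreal (exp (- t * ?m)) * ennreal (exp (t * ?m + t\<^sup>2 * V)) = ennreal (exp (t\<^sup>2 * V))"
    by (simp add: ennreal_mult[symmetric] exp_add[symmetric])
  finally show ?thesis by (simp add: ennreal_leI mult_left_mono)
qed

lemma (in prob_space) one_sided_deviation:
  fixes \<epsilon> :: real and f :: "'a \<Rightarrow> real" and n :: nat
  assumes f [measurable]: "f \<in> borel_measurable M" and bound: "AE x in M. \<bar>f x\<bar> \<le> b"
    and var: "expectation (\<lambda>x. (f x)\<^sup>2) \<le> V" and V: "0 < V"
    and \<epsilon>: "0 < \<epsilon>" "\<epsilon> * b \<le> 2 * V"
  shows "emeasure (PiM {..<n} (\<lambda>_. M))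
      {\<omega> \<in> space (PiM {..<n} (\<lambda>_. M)). n * \<epsilon> \<le> (\<Sum>i<n. f (\<omega> i) - expectation f)}
    \<le> ennreal (exp (- (n * \<epsilon>\<^sup>2 / (4 * V))))"
proof -
  let ?Q = "PiM {..<n} (\<lambda>_. M)" and ?m = "expectation f"
  interpret P: product_prob_space "\<lambda>_. M" "{..<n}" ..
  \<comment> \<open>This \<open>t\<close> minimises the Chernoff exponent \<open>- t * n * \<epsilon> + n * t\<^sup>2 * V\<close>.\<close>
  define t where "t = \<epsilon> / (2 * V)"
  have t: "0 < t" "t * b \<le> 1" using \<epsilon> V by (auto simp: t_def field_simps)
  have [measurable]: "(\<lambda>\<omega>. \<Sum>i<n. f (\<omega> i) - ?m) \<in> borel_measurable ?Q" by measurable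
  have "emeasure ?Q {\<omega> \<in> space ?Q. n * \<epsilon> \<le> (\<Sum>i<n. f (\<omega> i) - ?m)}
    \<le> ennreal (exp (- t * (n * \<epsilon>))) * (\<integral>\<^sup>+\<omega>. ennreal (exp (t * (\<Sum>i<n. f (\<omega> i) - ?m))) * indicator (space ?Q) \<omega> \<partial>?Q)"
    by (rule Chernoff_ineq_nn_integral_ge[OF t(1)]) auto
  also have "(\<integral>\<^sup>+\<omega>. ennreal (exp (t * (\<Sum>i<n. f (\<omega> i) - ?m))) * indicator (space ?Q) \<omega> \<partial>?Q)
      = (\<integral>\<^sup>+\<omega>. (\<Prod>i<n. ennreal (exp (t * (f (\<omega> i) - ?m)))) \<partial>?Q)"
  proof (intro nn_integral_cong)
    fix \<omega> assume "\<omega> \<in> space ?Q"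
    have "exp (t * (\<Sum>i<n. f (\<omega> i) - ?m)) = (\<Prod>i<n. exp (t * (f (\<omega> i) - ?m)))"
      unfolding sum_distrib_left by (rule exp_sum) simp
    then show "ennreal (exp (t * (\<Sum>i<n. f (\<omega> i) - ?m))) * indicator (space ?Q) \<omega> =
        (\<Prod>i<n. ennreal (exp (t * (f (\<omega> i) - ?m))))"
      using \<open>\<omega> \<in> space ?Q\<close> by (simp add: prod_ennreal)
  qed
  also have "\<dots> = (\<Prod>i<n. \<integral>\<^sup>+x. ennreal (exp (t * (f x - ?m))) \<partial>M)"
    by (rule P.product_nn_integral_prod) auto
  also have "\<dots> \<le> (\<Prod>i<n. ennreal (exp (t\<^sup>2 * V)))"
    using t by (intro prod_mono_ennreal exp_moment_bound[OF f bound var]) auto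
  also have "\<dots> = ennreal (exp (n * (t\<^sup>2 * V)))"
    by (simp add: ennreal_power exp_of_nat_mult)
  also have "ennreal (exp (- t * (n * \<epsilon>))) * ennreal (exp (n * (t\<^sup>2 * V))) = ennreal (exp (- (n * \<epsilon>\<^sup>2 / (4 * V))))"
  proof -
    have "- t * (n * \<epsilon>) + n * (t\<^sup>2 * V) = - (n * \<epsilon>\<^sup>2 / (4 * V))"
      using V by (simp add: t_def power2_eq_square field_simps)
    then show ?thesis by (simp only: ennreal_mult[symmetric] exp_ge_zero exp_add[symmetric])
  qed
  finally show ?thesis by (simp add: mult_left_mono)
qed

text \<open>For a nonnegative function, \<open>f\<^sup>2 \<le> b * f\<close> bounds the second moment by \<open>b * \<mu>\<close>. For the smoothed
  observations \<open>b\<close> grows like the inverse bandwidth volume while the mean stays bounded, which is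
  the variance order behind the rate.\<close>

lemma (in prob_space) mean_deviation:
  fixes \<epsilon> :: real and f :: "'a \<Rightarrow> real" and n :: nat
  assumes f [measurable]: "f \<in> borel_measurable M" and bound: "AE x in M. 0 \<le> f x \<and> f x \<le> b"
    and mean: "expectation f \<le> \<mu>" and pos: "0 < b" "1 \<le> \<mu>"
    and \<epsilon>: "0 < \<epsilon>" "\<epsilon> \<le> 2" and n: "0 < n"
  shows "emeasure (PiM {..<n} (\<lambda>_. M))
      {\<omega> \<in> space (PiM {..<n} (\<lambda>_. M)). \<epsilon> \<le> \<bar>(\<Sum>i<n. f (\<omega> i)) / n - expectation f\<bar>}
    \<le> ennreal (2 * exp (- (n * \<epsilon>\<^sup>2 / (4 * (b * \<mu>)))))"
proof -
  let ?Q = "PiM {..<n} (\<lambda>_. M)" and ?m = "expectation f"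
  let ?E = "\<lambda>f. {\<omega> \<in> space ?Q. n * \<epsilon> \<le> (\<Sum>i<n. f (\<omega> i) - expectation f)}"
  have intf: "integrable M f" by (rule integrable_const_bound[of _ b]) (use bound in auto)
  have abs: "AE x in M. \<bar>f x\<bar> \<le> b" using bound by eventually_elim auto
  have var: "expectation (\<lambda>x. (f x)\<^sup>2) \<le> b * \<mu>"
  proof -
    have "expectation (\<lambda>x. (f x)\<^sup>2) \<le> expectation (\<lambda>x. b * f x)"
    proof (rule integral_mono_AE')
      show "integrable M (\<lambda>x. b * f x)" using intf by simp
      show "AE x in M. (f x)\<^sup>2 \<le> b * f x"
        using bound by eventually_elim (simp add: power2_eq_square mult_right_mono)
      show "AE x in M. 0 \<le> b * f x"
        using bound pos by (auto elim!: eventually_mono)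
    qed
    also have "\<dots> = b * ?m" by simp
    also have "\<dots> \<le> b * \<mu>" using mean pos by simp
    finally show ?thesis .
  qed
  have V: "0 < b * \<mu>" using pos by simp
  have \<epsilon>': "\<epsilon> * b \<le> 2 * (b * \<mu>)"
  proof -
    have "\<epsilon> * b \<le> 2 * b" using \<epsilon> pos by simp
    also have "\<dots> \<le> 2 * (b * \<mu>)" using pos by simp
    finally show ?thesis .
  qed
  have meas: "?E f \<in> sets ?Q" "?E (\<lambda>x. - f x) \<in> sets ?Q" by measurable
  have "{\<omega> \<in> space ?Q. \<epsilon> \<le> \<bar>(\<Sum>i<n. f (\<omega> i)) / n - ?m\<bar>} \<subseteq> ?E f \<union> ?E (\<lambda>x. - f x)"
  proof safe
    fix \<omega> assume *: "\<epsilon> \<le> \<bar>(\<Sum>i<n. f (\<omega> i)) / n - ?m\<bar>" 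
      and **: "\<not> n * \<epsilon> \<le> (\<Sum>i<n. - f (\<omega> i) - expectation (\<lambda>x. - f x))"
    have "n * \<epsilon> \<le> \<bar>(\<Sum>i<n. f (\<omega> i)) - n * ?m\<bar>"
    proof -
      have "n * \<epsilon> \<le> n * \<bar>(\<Sum>i<n. f (\<omega> i)) / n - ?m\<bar>" using * by (intro mult_left_mono) auto
      also have "\<dots> = \<bar>n * ((\<Sum>i<n. f (\<omega> i)) / n - ?m)\<bar>" by (simp add: abs_mult)
      also have "n * ((\<Sum>i<n. f (\<omega> i)) / n - ?m) = (\<Sum>i<n. f (\<omega> i)) - n * ?m"
        using n by (simp add: right_diff_distrib)
      finally show ?thesis .
    qed
    then show "n * \<epsilon> \<le> (\<Sum>i<n. f (\<omega> i) - ?m)" using **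
      by (simp add: sum_subtractf sum_negf)
  qed
  then have "emeasure ?Q {\<omega> \<in> space ?Q. \<epsilon> \<le> \<bar>(\<Sum>i<n. f (\<omega> i)) / n - ?m\<bar>}
      \<le> emeasure ?Q (?E f) + emeasure ?Q (?E (\<lambda>x. - f x))"
    using meas by (intro order_trans[OF emeasure_mono emeasure_subadditive]) auto
  also have "\<dots> \<le> ennreal (exp (- (n * \<epsilon>\<^sup>2 / (4 * (b * \<mu>))))) + ennreal (exp (- (n * \<epsilon>\<^sup>2 / (4 * (b * \<mu>)))))"
    by (intro add_mono one_sided_deviation[where b = b] V \<epsilon>(1) \<epsilon>') (use abs var in auto)
  also have "\<dots> = ennreal (2 * exp (- (n * \<epsilon>\<^sup>2 / (4 * (b * \<mu>)))))"
    by (simp add: ennreal_plus[symmetric] del: ennreal_plus)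
  finally show ?thesis .
qed

section \<open>Mean and size of the smoothed observations\<close>

lemma kernel_average_le:
  assumes k: "controlled_kernel S A h k" and x: "x \<in> S" and S: "S \<in> sets borel"
    and F: "\<And>y. y \<in> S \<Longrightarrow> dist x y \<le> h \<Longrightarrow> F y \<le> c"
  shows "(\<integral>\<^sup>+y. indicator S y * (ennreal (k x y) * F y) \<partial>lborel) \<le> c"
proof -
  have [measurable]: "k x \<in> borel_measurable borel" and one: "(\<integral>\<^sup>+y. ennreal (indicator S y * k x y) \<partial>lborel) = 1"
    and far: "\<And>y. h < dist x y \<Longrightarrow> k x y = 0"
    using k x unfolding controlled_kernel_def by auto
  note S [measurable]
  have "(\<integral>\<^sup>+y. indicator S y * (ennreal (k x y) * F y) \<partial>lborel) \<le> (\<integral>\<^sup>+y. ennreal (indicator S y * k x y) * c \<partial>lborel)"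
  proof (rule nn_integral_mono)
    fix y
    show "indicator S y * (ennreal (k x y) * F y) \<le> ennreal (indicator S y * k x y) * c"
      using F[of y] far[of y] by (cases "y \<in> S"; cases "h < dist x y") (auto intro: mult_left_mono)
  qed
  also have "\<dots> = c" using one by (subst nn_integral_multc) auto
  finally show ?thesis .
qed

lemma kernel_average_ge:
  assumes k: "controlled_kernel S A h k" and x: "x \<in> S" and S: "S \<in> sets borel"
    and F: "\<And>y. y \<in> S \<Longrightarrow> dist x y \<le> h \<Longrightarrow> c \<le> F y"
  shows "c \<le> (\<integral>\<^sup>+y. indicator S y * (ennreal (k x y) * F y) \<partial>lborel)"
proof -
  have [measurable]: "k x \<in> borel_measurable borel" and one: "(\<integral>\<^sup>+y. ennreal (indicator S y * k x y) \<partial>lborel) = 1"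
    and far: "\<And>y. h < dist x y \<Longrightarrow> k x y = 0"
    using k x unfolding controlled_kernel_def by auto
  note S [measurable]
  have "c = (\<integral>\<^sup>+y. ennreal (indicator S y * k x y) * c \<partial>lborel)" using one by (subst nn_integral_multc) auto
  also have "\<dots> \<le> (\<integral>\<^sup>+y. indicator S y * (ennreal (k x y) * F y) \<partial>lborel)"
  proof (rule nn_integral_mono)
    fix y
    show "ennreal (indicator S y * k x y) * c \<le> indicator S y * (ennreal (k x y) * F y)"
      using F[of y] far[of y] by (cases "y \<in> S"; cases "h < dist x y") (auto intro: mult_left_mono)
  qed
  finally show ?thesis .
qed

lemma (in diagram_weight) compact_cltri: "compact (cltri L)"
proof -
  have "cltri L \<subseteq> cbox (0, 0) (L, L)" by (auto simp: cltri_def)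
  then have "bounded (cltri L)" by (rule bounded_subset[OF bounded_cbox])
  then show ?thesis using closed_cltri by (simp add: compact_eq_bounded_closed)
qed

lemma (in diagram_weight) convex_cltri: "convex (cltri L)"
proof -
  have "convex {u::real\<times>real. fst u \<le> snd u}" "convex {u::real\<times>real. 0 \<le> fst u}" "convex {u::real\<times>real. snd u \<le> L}"
    by (auto simp: convex_alt real_scaleR_def intro!: add_mono mult_left_mono convex_bound_le)
  then show ?thesis unfolding cltri_eq by (intro convex_Int)
qed

lemma (in diagram_weight) measure_cltri_pos:
  assumes "0 < L" shows "0 < measure lborel (cltri L)"
proof -
  have "cbox (0, L / 2) (L / 2, L) \<subseteq> cltri L" using assms by (auto simp: cltri_def)
  then have "measure lborel (cbox (0, L / 2) (L / 2, L)) \<le> measure lborel (cltri L)"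
    using emeasure_bounded_finite[OF compact_imp_bounded[OF compact_cltri]]
    by (intro measure_mono_fmeasurable) (auto simp: fmeasurable_def)
  moreover have "measure lborel (cbox (0, L / 2) (L / 2, L)) = L / 2 * (L / 2)"
    using assms by (subst content_cbox) (auto simp: Basis_prod_def)
  ultimately show ?thesis using assms by (metis half_gt_zero less_le_trans mult_pos_pos)
qed

context bm_law
begin

text \<open>A bound on the intensity that is uniform over the model: the mean value of \<open>l\<close> over the
  domain is at most \<open>Mw / measure lborel (cltri L)\<close>, so some value is, and Hoelder continuity limits the oscillation over the bounded
  domain.\<close>

definition l_max :: real where
  "l_max = Mw / measure lborel (cltri L) + LH * (diameter (unit_cube :: (real^'n) set) + diameter (cltri L)) powr s"

lemma l_max_nonneg: "0 \<le> l_max"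
  using Mw_pos LH_pos by (simp add: l_max_def)

lemma l_le_l_max:
  assumes "z1 \<in> unit_cube" "u1 \<in> cltri L"
  shows "l z1 u1 \<le> l_max"
proof (rule ccontr)
  assume *: "\<not> ?thesis"
  let ?a = "measure lborel (cltri L)"
  let ?R = "diameter (unit_cube :: (real^'n) set) + diameter (cltri L)"
  have a: "0 < ?a" using L_pos by (rule measure_cltri_pos)
  define c where "c = l z1 u1 - LH * ?R powr s"
  have c: "Mw / ?a < c" using * by (simp add: c_def l_max_def)
  have c_le: "c \<le> l z u" if "z \<in> unit_cube" "u \<in> cltri L" for z u
  proof -
    have "norm (z1 - z) \<le> diameter (unit_cube :: (real^'n) set)"
      using diameter_bounded_bound[of "unit_cube :: (real^'n) set" z1 z] assms that by (simp add: unit_cube_def dist_norm)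
    moreover have "norm (u1 - u) \<le> diameter (cltri L)"
      using diameter_bounded_bound[OF compact_imp_bounded[OF compact_cltri], of u1 u] assms that by (simp add: dist_norm)
    ultimately have "LH * (norm (z1 - z) + norm (u1 - u)) powr s \<le> LH * ?R powr s"
      using LH_pos s_pos by (intro mult_left_mono powr_mono2) auto
    then show ?thesis using l_holder[of z1 z u1 u] assms that by (auto simp: c_def)
  qed
  have fin: "emeasure lborel (cltri L) = ennreal ?a"
    using emeasure_bounded_finite[OF compact_imp_bounded[OF compact_cltri]]
    by (simp add: emeasure_eq_ennreal_measure top.not_eq_extremum)
  have "0 \<le> Mw / ?a" using Mw_pos by simp
  then have c0: "0 \<le> c" using c by linarith
  have "ennreal (c * ?a) = (\<integral>\<^sup>+z. indicator (unit_cube :: (real^'n) set) z * ennreal (c * ?a) \<partial>lborel)"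
    by (subst nn_integral_multc) (auto simp: emeasure_unit_cube)
  also have "\<dots> \<le> (\<integral>\<^sup>+z. indicator unit_cube z * (\<integral>\<^sup>+v. indicator (cltri L) v * ennreal (l z v) \<partial>lborel) \<partial>lborel)"
  proof (rule nn_integral_mono)
    fix z :: "real^'n"
    have "ennreal (c * ?a) = (\<integral>\<^sup>+v. indicator (cltri L) v * ennreal c \<partial>lborel)"
      using c0 a by (subst nn_integral_multc) (auto simp: fin ennreal_mult mult.commute)
    also have "\<dots> \<le> (\<integral>\<^sup>+v. indicator (cltri L) v * ennreal (l z v) \<partial>lborel)" if "z \<in> unit_cube"
      using c_le[OF that] by (intro nn_integral_mono) (auto simp: indicator_def ennreal_leI)
    finally show "indicator unit_cube z * ennreal (c * ?a) \<le>
        indicator unit_cube z * (\<integral>\<^sup>+v. indicator (cltri L) v * ennreal (l z v) \<partial>lborel)"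
      by (cases "z \<in> unit_cube") auto
  qed
  also have "\<dots> \<le> ennreal Mw" by (rule mean_mass)
  finally have "c * ?a \<le> Mw" using Mw_pos by simp
  then show False using c a by (simp add: field_simps)
qed

end

locale smoothed_law = bm_law L w P s LH Mw l
  for L w and P :: "((real ^ 'n) \<times> diagram) measure" and s LH Mw l +
  fixes kZ :: "real ^ 'n \<Rightarrow> real ^ 'n \<Rightarrow> real" and kU :: "real \<times> real \<Rightarrow> real \<times> real \<Rightarrow> real"
    and A hZ hU :: real
  assumes kZ: "controlled_kernel unit_cube A hZ kZ" and kU: "controlled_kernel (cltri L) A hU kU"
    and A: "1 \<le> A" and hZ: "0 < hZ" "hZ \<le> 1" and hU: "0 < hU" "hU \<le> 1"
begin

lemma kZ_props:
  assumes "z \<in> unit_cube"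
  shows "kZ z \<in> borel_measurable borel" "0 \<le> kZ z y" "kZ z y \<le> A / hZ ^ CARD('n)"
    "(\<integral>\<^sup>+y. ennreal (indicator unit_cube y * kZ z y) \<partial>lborel) = 1"
    "z' \<in> unit_cube \<Longrightarrow> \<bar>kZ z y - kZ z' y\<bar> \<le> A / hZ ^ (2 * CARD('n) + 1) * norm (z - z')"
  using kZ assms unfolding controlled_kernel_def by auto

lemma kU_props:
  assumes "u \<in> cltri L"
  shows "kU u \<in> borel_measurable borel" "0 \<le> kU u v" "kU u v \<le> A / hU ^ 2"
    "u' \<in> cltri L \<Longrightarrow> \<bar>kU u v - kU u' v\<bar> \<le> A / hU ^ 5 * norm (u - u')"
  using kU assms unfolding controlled_kernel_def by (auto simp: power2_eq_square simp del: split_paired_All)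

definition Y :: "diagram \<Rightarrow> real \<times> real \<Rightarrow> real" where
  "Y D u = (LINT v:cltri L|weighted_measure L w D. kU u v)"

text \<open>Almost every diagram is light. On light diagrams the bounds below hold pointwise, so the
  suprema over \<open>(z, u)\<close> need no measurability.\<close>

definition light :: "diagram \<Rightarrow> bool" where
  "light D \<longleftrightarrow> emeasure (weighted_measure L w D) UNIV \<le> ennreal Mw"

lemma AE_light: "AE \<omega> in P. light (snd \<omega>)"
  using mass by eventually_elim (use emeasure_weighted_measure_cltri[of UNIV] in \<open>simp add: light_def\<close>)

lemma light_finite: "light D \<Longrightarrow> finite_measure (weighted_measure L w D)"
  unfolding light_def by (intro finite_measureI) (auto simp: top_unique)

lemma measure_light: "light D \<Longrightarrow> measure (weighted_measure L w D) UNIV \<le> Mw"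
  unfolding light_def measure_def using Mw_pos by (simp add: enn2real_leI)

lemma Y_eq:
  assumes u: "u \<in> cltri L" 
  shows "Y D u = enn2real (\<integral>\<^sup>+v. ennreal (kU u v) \<partial>weighted_measure L w D)"
proof -
  note kU_props(1)[OF u, measurable]
  have "Y D u = enn2real (\<integral>\<^sup>+v. ennreal (indicator (cltri L) v * kU u v) \<partial>weighted_measure L w D)"
    unfolding Y_def set_lebesgue_integral_def using kU_props(2)[OF u]
    by (subst integral_eq_nn_integral) auto
  also have "(\<integral>\<^sup>+v. ennreal (indicator (cltri L) v * kU u v) \<partial>weighted_measure L w D) =
      (\<integral>\<^sup>+v. indicator (cltri L) v * ennreal (kU u v) \<partial>weighted_measure L w D)"
    by (intro nn_integral_cong) (auto simp: indicator_def)
  also have "\<dots> = (\<integral>\<^sup>+v. ennreal (kU u v) \<partial>weighted_measure L w D)"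
    by (rule nn_integral_weighted_measure_cltri) simp
  finally show ?thesis .
qed

lemma Y_measurable:
  assumes u: "u \<in> cltri L"
  shows "(\<lambda>D. Y D u) \<in> borel_measurable (diagram_space L)"
proof -
  note kU_props(1)[OF u, measurable]
  have [measurable]: "(\<lambda>D. \<integral>\<^sup>+v. ennreal (kU u v) \<partial>weighted_measure L w D) \<in> borel_measurable (diagram_space L)"
    by (rule measurable_nn_integral_weighted_measure) simp
  show ?thesis unfolding Y_eq[OF u] by measurable
qed

lemma light_integrable:
  assumes "light D" and [measurable]: "f \<in> borel_measurable borel" and "\<And>v. \<bar>f v\<bar> \<le> c"
  shows "integrable (weighted_measure L w D) (\<lambda>v. indicator (cltri L) v *\<^sub>R f v)"
    and "\<bar>\<integral>v. indicator (cltri L) v *\<^sub>R f v \<partial>weighted_measure L w D\<bar> \<le> c * Mw"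
proof -
  interpret W: finite_measure "weighted_measure L w D" using assms(1) by (rule light_finite)
  have c: "0 \<le> c" using assms(3)[of 0] by linarith
  have b: "\<bar>indicator (cltri L) v *\<^sub>R f v\<bar> \<le> c" for v using assms(3)[of v] c by (auto simp: indicator_def)
  show int: "integrable (weighted_measure L w D) (\<lambda>v. indicator (cltri L) v *\<^sub>R f v)"
    by (rule W.integrable_const_bound[of _ c]) (use b in auto)
  have "\<bar>\<integral>v. indicator (cltri L) v *\<^sub>R f v \<partial>weighted_measure L w D\<bar> \<le> (\<integral>v. c \<partial>weighted_measure L w D)"
    by (rule integral_abs_bound[THEN order_trans], rule integral_mono) (use int b in auto)
  also have "\<dots> = c * measure (weighted_measure L w D) UNIV" by simp
  also have "\<dots> \<le> c * Mw" using measure_light[OF assms(1)] c by (rule mult_left_mono)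
  finally show "\<bar>\<integral>v. indicator (cltri L) v *\<^sub>R f v \<partial>weighted_measure L w D\<bar> \<le> c * Mw" .
qed

lemma Y_nonneg: "u \<in> cltri L \<Longrightarrow> 0 \<le> Y D u"
  by (simp add: Y_eq)

lemma Y_le: "light D \<Longrightarrow> u \<in> cltri L \<Longrightarrow> Y D u \<le> A / hU ^ 2 * Mw"
  using light_integrable(2)[of D "kU u" "A / hU ^ 2"] kU_props
  by (simp add: Y_def set_lebesgue_integral_def abs_le_iff)

lemma Y_lipschitz:
  assumes D: "light D" and u: "u \<in> cltri L" "u' \<in> cltri L"
  shows "\<bar>Y D u - Y D u'\<bar> \<le> A / hU ^ 5 * norm (u - u') * Mw"
proof -
  note kU_props(1)[OF u(1), measurable] kU_props(1)[OF u(2), measurable]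
  have int: "integrable (weighted_measure L w D) (\<lambda>v. indicator (cltri L) v *\<^sub>R kU u v)" if "u \<in> cltri L" for u
    by (rule light_integrable(1)[OF D, where c = "A / hU ^ 2"]) (use kU_props[OF that] in auto)
  have "Y D u - Y D u' = (\<integral>v. indicator (cltri L) v *\<^sub>R (kU u v - kU u' v) \<partial>weighted_measure L w D)"
    unfolding Y_def set_lebesgue_integral_def
    by (subst Bochner_Integration.integral_diff[symmetric, OF int[OF u(1)] int[OF u(2)]]) (simp add: right_diff_distrib)
  then show ?thesis
    using light_integrable(2)[OF D, of "\<lambda>v. kU u v - kU u' v" "A / hU ^ 5 * norm (u - u')"] kU_props(4)[OF u(1) u(2)]
    by simp
qed

lemma ennreal_Y:
  assumes D: "light D" and u: "u \<in> cltri L"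
  shows "ennreal (Y D u) = (\<integral>\<^sup>+v. ennreal (kU u v) \<partial>weighted_measure L w D)"
proof -
  have "(\<integral>\<^sup>+v. ennreal (kU u v) \<partial>weighted_measure L w D) \<le> (\<integral>\<^sup>+v. ennreal (A / hU ^ 2) \<partial>weighted_measure L w D)"
    using kU_props(3)[OF u] by (intro nn_integral_mono ennreal_leI)
  also have "\<dots> = ennreal (A / hU ^ 2) * emeasure (weighted_measure L w D) UNIV" by simp
  also have "\<dots> < \<top>" using D unfolding light_def
    by (intro ennreal_mult_less_top[THEN iffD2]) (auto simp: le_less_trans)
  finally show ?thesis unfolding Y_eq[OF u] by simp
qed

abbreviation "bias \<equiv> LH * (hZ + hU) powr s"

definition X :: "real ^ 'n \<Rightarrow> real \<times> real \<Rightarrow> (real ^ 'n) \<times> diagram \<Rightarrow> real" where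
  "X z u \<omega> = kZ z (fst \<omega>) * Y (snd \<omega>) u"

lemma kZ_measurable: "z \<in> unit_cube \<Longrightarrow> (\<lambda>\<omega>. kZ z (fst \<omega>)) \<in> borel_measurable P"
  using measurable_compose[OF fst_measurable kZ_props(1)] by simp

lemma X_measurable: "z \<in> unit_cube \<Longrightarrow> u \<in> cltri L \<Longrightarrow> X z u \<in> borel_measurable P"
  unfolding X_def using kZ_measurable measurable_compose[OF snd_measurable Y_measurable] by simp

lemma X_bound:
  assumes "z \<in> unit_cube" "u \<in> cltri L"
  shows "AE \<omega> in P. 0 \<le> X z u \<omega> \<and> X z u \<omega> \<le> A\<^sup>2 * (Mw + 1) / (hZ ^ CARD('n) * hU\<^sup>2)"
  using AE_light
proof eventually_elim
  case (elim \<omega>)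
  have "X z u \<omega> \<le> (A / hZ ^ CARD('n)) * (A / hU ^ 2 * Mw)"
    unfolding X_def using assms elim A hZ
    by (intro mult_mono kZ_props Y_le Y_nonneg) auto
  also have "\<dots> = A\<^sup>2 * Mw / (hZ ^ CARD('n) * hU\<^sup>2)" by (simp add: power2_eq_square)
  also have "\<dots> \<le> A\<^sup>2 * (Mw + 1) / (hZ ^ CARD('n) * hU\<^sup>2)"
    using hZ hU by (intro divide_right_mono mult_left_mono) auto
  finally show ?case using kZ_props(2) Y_nonneg assms by (simp add: X_def)
qed

lemma kZ_bound:
  assumes "z \<in> unit_cube"
  shows "0 \<le> kZ z y \<and> kZ z y \<le> A\<^sup>2 * (Mw + 1) / (hZ ^ CARD('n) * hU\<^sup>2)"
proof -
  have "kZ z y \<le> A / hZ ^ CARD('n)" using assms by (rule kZ_props)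
  also have "\<dots> \<le> (A / hZ ^ CARD('n)) * (A * (Mw + 1) / hU\<^sup>2)"
  proof -
    have "1 * 1 \<le> A * (Mw + 1)" using A Mw_pos by (intro mult_mono) auto
    moreover have "hU\<^sup>2 \<le> 1" using hU by (simp add: power_le_one)
    ultimately have "1 \<le> A * (Mw + 1) / hU\<^sup>2" using hU by simp
    then show ?thesis using mult_left_mono[of 1 "A * (Mw + 1) / hU\<^sup>2" "A / hZ ^ CARD('n)"] A hZ by simp
  qed
  finally show ?thesis using kZ_props(2)[OF assms] by (simp add: power2_eq_square mult_ac)
qed

lemma mean_kZ: "z \<in> unit_cube \<Longrightarrow> expectation (\<lambda>\<omega>. kZ z (fst \<omega>)) = 1"
proof -
  assume z: "z \<in> unit_cube"
  note kZ_props(1)[OF z, measurable]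
  have "(\<integral>\<^sup>+\<omega>. ennreal (kZ z (fst \<omega>)) \<partial>P) = (\<integral>\<^sup>+y. indicator unit_cube y * ennreal (kZ z y) \<partial>lborel)"
    by (rule nn_integral_uniform_cube[OF uniform]) auto
  also have "\<dots> = (\<integral>\<^sup>+y. ennreal (indicator unit_cube y * kZ z y) \<partial>lborel)"
    by (intro nn_integral_cong) (auto simp: indicator_def)
  also have "\<dots> = 1" using z by (rule kZ_props)
  finally have "(\<integral>\<^sup>+\<omega>. ennreal (kZ z (fst \<omega>)) \<partial>P) = 1" .
  then show ?thesis
    using kZ_props(2)[OF z] by (subst integral_eq_nn_integral) auto
qed

text \<open>The bias. Both kernels have total mass one on their domains, so the mean is an average of values
  of \<open>l\<close> at points whose coordinates are within \<open>hZ\<close> and \<open>hU\<close> of \<open>(z, u)\<close>, also near the boundary.\<close>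

lemma mean_X:
  assumes z: "z \<in> unit_cube" and u: "u \<in> cltri L"
  shows "\<bar>expectation (X z u) - l z u\<bar> \<le> bias"
proof -
  note kZ_props(1)[OF z, measurable] kU_props(1)[OF u, measurable]
  let ?I = "\<integral>\<^sup>+z'. indicator unit_cube z' * (ennreal (kZ z z') *
      (\<integral>\<^sup>+v. indicator (cltri L) v * (ennreal (kU u v) * ennreal (l z' v)) \<partial>lborel)) \<partial>lborel"
  have "ennreal (expectation (X z u)) = (\<integral>\<^sup>+\<omega>. ennreal (X z u \<omega>) \<partial>P)"
  proof (rule nn_integral_eq_integral[symmetric])
    show "integrable P (X z u)"
      by (rule integrable_const_bound[of _ "A\<^sup>2 * (Mw + 1) / (hZ ^ CARD('n) * hU\<^sup>2)"])
         (use X_bound[OF z u] X_measurable[OF z u] in auto)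
    show "AE \<omega> in P. 0 \<le> X z u \<omega>" using X_bound[OF z u] by auto
  qed
  also have "\<dots> = (\<integral>\<^sup>+\<omega>. ennreal (kZ z (fst \<omega>)) * (\<integral>\<^sup>+v. ennreal (kU u v) \<partial>weighted_measure L w (snd \<omega>)) \<partial>P)"
    by (intro nn_integral_cong_AE, use AE_light in eventually_elim)
       (use ennreal_Y kZ_props(2) Y_nonneg z u in \<open>simp add: X_def ennreal_mult\<close>)
  also have "\<dots> = ?I" by (rule campbell) measurable
  finally have eq: "ennreal (expectation (X z u)) = ?I" .
  have close: "\<bar>l z u - l z' v\<bar> \<le> bias"
    if "z' \<in> unit_cube" "dist z z' \<le> hZ" "v \<in> cltri L" "dist u v \<le> hU" for z' v
  proof -
    have "\<bar>l z u - l z' v\<bar> \<le> LH * (norm (z - z') + norm (u - v)) powr s"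
      using z u that by (intro l_holder)
    also have "\<dots> \<le> bias"
      using that s_pos LH_pos by (intro mult_left_mono powr_mono2 add_mono) (auto simp: dist_norm)
    finally show ?thesis .
  qed
  have le: "l z' v \<le> l z u + bias" and ge: "l z u - bias \<le> l z' v"
    if "z' \<in> unit_cube" "dist z z' \<le> hZ" "v \<in> cltri L" "dist u v \<le> hU" for z' v
    using close[OF that] by linarith+
  have "?I \<le> ennreal (l z u + bias)"
    by (intro kernel_average_le[OF kZ z] kernel_average_le[OF kU u] ennreal_leI le) auto
  moreover have "ennreal (l z u - bias) \<le> ?I"
    by (intro kernel_average_ge[OF kZ z] kernel_average_ge[OF kU u] ennreal_leI ge) auto
  moreover have "0 \<le> expectation (X z u)"
    by (rule integral_nonneg_AE) (use X_bound[OF z u] in auto)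
  moreover have "0 \<le> l z u + bias" using l_nonneg[OF z u] LH_pos by simp
  ultimately show ?thesis unfolding eq[symmetric] by (auto simp: abs_le_iff ennreal_le_iff2)
qed

end

section \<open>Uniform error of the ratio estimator\<close>

lemma mean_diff_le:
  fixes a b :: "nat \<Rightarrow> real"
  assumes "0 < n" "\<And>i. i < n \<Longrightarrow> \<bar>a i - b i\<bar> \<le> c"
  shows "\<bar>(\<Sum>i<n. a i) / n - (\<Sum>i<n. b i) / n\<bar> \<le> c"
proof -
  have "\<bar>\<Sum>i<n. a i - b i\<bar> \<le> (\<Sum>i<n. c)"
    by (rule order_trans[OF sum_abs sum_mono]) (use assms in auto)
  then have "\<bar>(\<Sum>i<n. a i) - (\<Sum>i<n. b i)\<bar> \<le> n * c" by (simp add: sum_subtractf)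
  moreover have "\<bar>(\<Sum>i<n. a i) / n - (\<Sum>i<n. b i) / n\<bar> = \<bar>(\<Sum>i<n. a i) - (\<Sum>i<n. b i)\<bar> / n"
    by (simp add: diff_divide_distrib[symmetric])
  ultimately show ?thesis using assms(1) by (simp add: divide_le_eq mult.commute)
qed

context smoothed_law
begin

definition num :: "nat \<Rightarrow> (nat \<Rightarrow> (real ^ 'n) \<times> diagram) \<Rightarrow> real ^ 'n \<Rightarrow> real \<times> real \<Rightarrow> real" where
  "num n \<omega> z u = (\<Sum>i<n. X z u (\<omega> i)) / n"

definition den :: "nat \<Rightarrow> (nat \<Rightarrow> (real ^ 'n) \<times> diagram) \<Rightarrow> real ^ 'n \<Rightarrow> real" where
  "den n \<omega> z = (\<Sum>i<n. kZ z (fst (\<omega> i))) / n"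

definition ratio :: "nat \<Rightarrow> (nat \<Rightarrow> (real ^ 'n) \<times> diagram) \<Rightarrow> real ^ 'n \<Rightarrow> real \<times> real \<Rightarrow> real" where
  "ratio n \<omega> z u =
     (let den = (\<Sum>i<n. kZ z (fst (\<omega> i)))
      in if den = 0 then 0 else (\<Sum>i<n. kZ z (fst (\<omega> i)) * Y (snd (\<omega> i)) u) / den)"

lemma X_lipschitz:
  assumes \<omega>: "light (snd \<omega>)" and z: "z \<in> unit_cube" "z' \<in> unit_cube" and u: "u \<in> cltri L" "u' \<in> cltri L"
    and \<eta>: "norm (z - z') \<le> \<eta>" "norm (u - u') \<le> \<eta>"
  shows "\<bar>X z u \<omega> - X z' u' \<omega>\<bar> \<le> 2 * A\<^sup>2 * Mw * \<eta> / (hZ ^ (2 * CARD('n) + 1) * hU ^ 5)"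
proof -
  let ?y = "fst \<omega>" and ?D = "snd \<omega>" and ?N = "2 * CARD('n) + 1"
  have \<eta>0: "0 \<le> \<eta>" using \<eta>(1) norm_ge_zero order_trans by blast
  have "X z u \<omega> - X z' u' \<omega> = (kZ z ?y - kZ z' ?y) * Y ?D u + kZ z' ?y * (Y ?D u - Y ?D u')"
    by (simp add: X_def algebra_simps)
  also have "\<bar>\<dots>\<bar> \<le> \<bar>kZ z ?y - kZ z' ?y\<bar> * Y ?D u + kZ z' ?y * \<bar>Y ?D u - Y ?D u'\<bar>"
    using Y_nonneg[OF u(1), of ?D] kZ_props(2)[OF z(2), of ?y]
    by (intro order_trans[OF abs_triangle_ineq]) (simp add: abs_mult)
  also have "\<dots> \<le> (A / hZ ^ ?N * \<eta>) * (A / hU ^ 2 * Mw) + (A / hZ ^ CARD('n)) * (A / hU ^ 5 * \<eta> * Mw)"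
  proof (intro add_mono mult_mono)
    show "\<bar>kZ z ?y - kZ z' ?y\<bar> \<le> A / hZ ^ ?N * \<eta>"
      using A hZ \<eta> by (intro order_trans[OF kZ_props(5)[OF z]] mult_left_mono) auto
    show "\<bar>Y ?D u - Y ?D u'\<bar> \<le> A / hU ^ 5 * \<eta> * Mw"
      using A hU \<eta> Mw_pos by (intro order_trans[OF Y_lipschitz[OF \<omega> u]] mult_left_mono mult_right_mono) auto
  qed (use \<omega> z u A hZ hU \<eta>0 Mw_pos Y_le Y_nonneg kZ_props in auto)
  also have "\<dots> \<le> (A / hZ ^ ?N * \<eta>) * (A / hU ^ 5 * Mw) + (A / hZ ^ ?N) * (A / hU ^ 5 * \<eta> * Mw)"
    using A hZ hU \<eta>0 Mw_pos
    by (intro add_mono mult_left_mono mult_right_mono divide_left_mono power_decreasing) auto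
  also have "\<dots> = 2 * A\<^sup>2 * Mw * \<eta> / (hZ ^ ?N * hU ^ 5)" by (simp add: power2_eq_square mult_ac)
  finally show ?thesis .
qed

text \<open>The deterministic half of the proof: if numerator and denominator concentrate at the net point
  \<open>(z', u')\<close>, then the ratio is accurate at every \<open>(z, u)\<close> nearby. The bias enters twice, as the
  bias at the net point and as the oscillation of \<open>l\<close> between the two points.\<close>

lemma ratio_error:
  assumes n: "0 < n" and light: "\<And>i. i < n \<Longrightarrow> light (snd (\<omega> i))"
    and z: "z \<in> unit_cube" "z' \<in> unit_cube" and u: "u \<in> cltri L" "u' \<in> cltri L"
    and close: "norm (z - z') \<le> \<eta>" "norm (u - u') \<le> \<eta>"
    and \<eta>: "2 * A\<^sup>2 * (Mw + 1) * \<eta> / (hZ ^ (2 * CARD('n) + 1) * hU ^ 5) \<le> \<epsilon>" "\<eta> \<le> hZ" "\<eta> \<le> hU"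
    and \<epsilon>: "0 < \<epsilon>" "\<epsilon> \<le> 1 / 4"
    and num: "\<bar>num n \<omega> z' u' - expectation (X z' u')\<bar> \<le> \<epsilon>"
    and den: "\<bar>den n \<omega> z' - 1\<bar> \<le> \<epsilon>"
  shows "\<bar>ratio n \<omega> z u - l z u\<bar> \<le> 4 * (\<epsilon> + bias + l_max * \<epsilon>)"
proof -
  let ?N = "2 * CARD('n) + 1"
  have \<eta>0: "0 \<le> \<eta>" using close(1) norm_ge_zero order_trans by blast
  let ?l = "2 * A\<^sup>2 * (Mw + 1) * \<eta> / (hZ ^ ?N * hU ^ 5)"
  have "\<bar>num n \<omega> z u - num n \<omega> z' u'\<bar> \<le> 2 * A\<^sup>2 * Mw * \<eta> / (hZ ^ ?N * hU ^ 5)"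
    unfolding num_def using X_lipschitz[OF light z u close] by (intro mean_diff_le n) auto
  also have "\<dots> \<le> ?l" using hZ hU \<eta>0 by (intro divide_right_mono mult_right_mono mult_left_mono) auto
  finally have num1: "\<bar>num n \<omega> z u - num n \<omega> z' u'\<bar> \<le> \<epsilon>" using \<eta>(1) by linarith
  have "\<bar>den n \<omega> z - den n \<omega> z'\<bar> \<le> A / hZ ^ ?N * \<eta>"
    unfolding den_def
  proof (intro mean_diff_le n)
    fix i
    show "\<bar>kZ z (fst (\<omega> i)) - kZ z' (fst (\<omega> i))\<bar> \<le> A / hZ ^ ?N * \<eta>"
      using A hZ close by (intro order_trans[OF kZ_props(5)[OF z]] mult_left_mono) auto
  qed
  also have "A / hZ ^ ?N * \<eta> \<le> (A / hZ ^ ?N * \<eta>) * (2 * A * (Mw + 1) / hU ^ 5)"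
  proof -
    have "1 * 1 \<le> A * (Mw + 1)" using A Mw_pos by (intro mult_mono) auto
    moreover have "hU ^ 5 \<le> 1" using hU by (simp add: power_le_one)
    ultimately have "1 \<le> 2 * A * (Mw + 1) / hU ^ 5" using hU by simp
    then show ?thesis using mult_left_mono[of 1 "2 * A * (Mw + 1) / hU ^ 5" "A / hZ ^ ?N * \<eta>"] A hZ \<eta>0 by simp
  qed
  also have "\<dots> = ?l" by (simp add: power2_eq_square)
  finally have den1: "\<bar>den n \<omega> z - den n \<omega> z'\<bar> \<le> \<epsilon>" using \<eta>(1) by linarith
  have "\<bar>l z' u' - l z u\<bar> \<le> LH * (norm (z' - z) + norm (u' - u)) powr s"
    using z u by (intro l_holder)
  also have "\<dots> \<le> bias" using close \<eta> s_pos LH_pos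
    by (intro mult_left_mono powr_mono2 add_mono) (auto simp: norm_minus_commute)
  finally have l1: "\<bar>l z' u' - l z u\<bar> \<le> bias" .
  have l2: "0 \<le> l z u" "l z u \<le> l_max" using l_nonneg l_le_l_max z u by auto
  have num2: "\<bar>num n \<omega> z u - l z u\<bar> \<le> 2 * (\<epsilon> + bias)"
  proof -
    have chain: "\<bar>x - y\<bar> \<le> 2 * (e + b)"
      if "\<bar>a - m\<bar> \<le> e" "\<bar>x - a\<bar> \<le> e" "\<bar>m - c\<bar> \<le> b" "\<bar>c - y\<bar> \<le> b" for x a m c y e b :: real
      using that unfolding abs_le_iff by auto
    show ?thesis by (rule chain[OF num num1 mean_X[OF z(2) u(2)] l1])
  qed
  have den2: "\<bar>den n \<omega> z - 1\<bar> \<le> 2 * \<epsilon>" using den den1 by linarith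
  \<comment> \<open>This also excludes the default value of the ratio at a zero denominator.\<close>
  then have half: "1 / 2 \<le> den n \<omega> z" using \<epsilon> by linarith
  have ratio: "ratio n \<omega> z u = num n \<omega> z u / den n \<omega> z"
    using half n by (auto simp: ratio_def num_def den_def X_def Let_def)
  have "\<bar>num n \<omega> z u - l z u * den n \<omega> z\<bar> \<le> \<bar>num n \<omega> z u - l z u\<bar> + \<bar>l z u * (1 - den n \<omega> z)\<bar>"
    by (simp add: algebra_simps)
  also have "\<dots> \<le> 2 * (\<epsilon> + bias) + l_max * (2 * \<epsilon>)"
    using num2 den2 l2 by (intro add_mono) (auto simp: abs_mult abs_minus_commute intro!: mult_mono)
  finally have *: "\<bar>num n \<omega> z u - l z u * den n \<omega> z\<bar> \<le> 2 * (\<epsilon> + bias + l_max * \<epsilon>)" by simp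
  have "\<bar>ratio n \<omega> z u - l z u\<bar> = \<bar>num n \<omega> z u - l z u * den n \<omega> z\<bar> / den n \<omega> z"
  proof -
    have "ratio n \<omega> z u - l z u = (num n \<omega> z u - l z u * den n \<omega> z) / den n \<omega> z"
      unfolding ratio using half by (simp add: field_simps)
    then show ?thesis using half by (simp add: abs_divide)
  qed
  also have "\<dots> \<le> (2 * (\<epsilon> + bias + l_max * \<epsilon>)) / (1 / 2)"
    using * half by (intro frac_le) auto
  finally show ?thesis by simp
qed

text \<open>Union bound over a net. The bad event need not be measurable, but it is covered by the null event
  of a diagram that is not light and by the deviation events at the net points, which are.\<close>

lemma finite_sample_bound:
  fixes G :: "((real ^ 'n) \<times> (real \<times> real)) set"
  assumes n: "0 < n" and G: "finite G" "G \<subseteq> unit_cube \<times> cltri L"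
    and net: "\<And>z u. z \<in> unit_cube \<Longrightarrow> u \<in> cltri L \<Longrightarrow>
      \<exists>g\<in>G. norm (z - fst g) \<le> \<eta> \<and> norm (u - snd g) \<le> \<eta>"
    and \<eta>: "2 * A\<^sup>2 * (Mw + 1) * \<eta> / (hZ ^ (2 * CARD('n) + 1) * hU ^ 5) \<le> \<epsilon>" "\<eta> \<le> hZ" "\<eta> \<le> hU"
    and \<epsilon>: "0 < \<epsilon>" "\<epsilon> \<le> 1 / 4"
    and T: "4 * (\<epsilon> + bias + l_max * \<epsilon>) \<le> T"
  shows "sample_prob P n (\<lambda>\<omega>. ennreal T < sup_norm L (\<lambda>z u. ratio n \<omega> z u - l z u)) \<le>
    ennreal (4 * real (card G) * exp (- (n * \<epsilon>\<^sup>2 * (hZ ^ CARD('n) * hU\<^sup>2) /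
      (4 * (A\<^sup>2 * (Mw + 1) * (l_max + LH * 2 powr s + 1))))))"
proof -
  let ?Q = "PiM {..<n} (\<lambda>_. P)"
  let ?b = "A\<^sup>2 * (Mw + 1) / (hZ ^ CARD('n) * hU\<^sup>2)" and ?\<mu> = "l_max + LH * 2 powr s + 1"
  let ?p = "ennreal (2 * exp (- (n * \<epsilon>\<^sup>2 / (4 * (?b * ?\<mu>)))))"
  define B1 where "B1 g = {\<omega> \<in> space ?Q. \<epsilon> \<le> \<bar>num n \<omega> (fst g) (snd g) - expectation (X (fst g) (snd g))\<bar>}" for g
  define B2 where "B2 g = {\<omega> \<in> space ?Q. \<epsilon> \<le> \<bar>den n \<omega> (fst g) - 1\<bar>}" for g :: "(real ^ 'n) \<times> (real \<times> real)"
  have b: "0 < ?b" using A Mw_pos hZ hU by simp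
  have biasle: "bias \<le> LH * 2 powr s"
    using hZ hU s_pos LH_pos by (intro mult_left_mono powr_mono2) auto
  have \<mu>: "1 \<le> ?\<mu>" using l_max_nonneg LH_pos by simp
  have mem: "fst g \<in> unit_cube" "snd g \<in> cltri L" if "g \<in> G" for g using that G(2) by auto
  have B1: "emeasure ?Q (B1 g) \<le> ?p" if "g \<in> G" for g
    unfolding B1_def num_def
  proof (rule mean_deviation[OF X_measurable X_bound])
    show "expectation (X (fst g) (snd g)) \<le> ?\<mu>"
      using mean_X[OF mem[OF that]] l_le_l_max[OF mem[OF that]] biasle by linarith
  qed (use mem[OF that] b \<mu> \<epsilon> n in auto)
  have B2: "emeasure ?Q (B2 g) \<le> ?p" if "g \<in> G" for g
  proof -
    have "emeasure ?Q {\<omega> \<in> space ?Q. \<epsilon> \<le> \<bar>(\<Sum>i<n. kZ (fst g) (fst (\<omega> i))) / n -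
        expectation (\<lambda>\<omega>. kZ (fst g) (fst \<omega>))\<bar>} \<le> ?p"
    proof (rule mean_deviation[OF kZ_measurable])
    show "AE \<omega> in P. 0 \<le> kZ (fst g) (fst \<omega>) \<and> kZ (fst g) (fst \<omega>) \<le> ?b"
      using kZ_bound[OF mem(1)[OF that]] by simp
    show "expectation (\<lambda>\<omega>. kZ (fst g) (fst \<omega>)) \<le> ?\<mu>"
      using mean_kZ[OF mem(1)[OF that]] \<mu> by simp
    qed (use mem[OF that] b \<mu> \<epsilon> n in auto)
    then show ?thesis using mean_kZ[OF mem(1)[OF that]] by (simp add: B2_def den_def)
  qed
  have comp [measurable]: "(\<lambda>\<omega>. \<omega> i) \<in> ?Q \<rightarrow>\<^sub>M P" if "i < n" for i using that by simp
  have B1m: "B1 g \<in> sets ?Q" if "g \<in> G" for g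
  proof -
    have "(\<lambda>\<omega>. num n \<omega> (fst g) (snd g)) \<in> borel_measurable ?Q"
      unfolding num_def by (intro borel_measurable_divide borel_measurable_sum borel_measurable_const
        measurable_compose[OF comp X_measurable] mem[OF that]) auto
    then show ?thesis unfolding B1_def by measurable
  qed
  have B2m: "B2 g \<in> sets ?Q" if "g \<in> G" for g
  proof -
    have "(\<lambda>\<omega>. den n \<omega> (fst g)) \<in> borel_measurable ?Q"
      unfolding den_def by (intro borel_measurable_divide borel_measurable_sum borel_measurable_const
        measurable_compose[OF comp kZ_measurable] mem[OF that]) auto
    then show ?thesis unfolding B2_def by measurable
  qed
  have "AE \<omega> in ?Q. \<forall>i\<in>{..<n}. light (snd (\<omega> i))"
    by (intro AE_finite_allI AE_PiM_component AE_light prob) auto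
  then obtain N where N: "{\<omega> \<in> space ?Q. \<not> (\<forall>i\<in>{..<n}. light (snd (\<omega> i)))} \<subseteq> N"
    "emeasure ?Q N = 0" "N \<in> sets ?Q" by (rule AE_E)
  let ?bad = "N \<union> ((\<Union>g\<in>G. B1 g) \<union> (\<Union>g\<in>G. B2 g))"
  have "{\<omega> \<in> space ?Q. ennreal T < sup_norm L (\<lambda>z u. ratio n \<omega> z u - l z u)} \<subseteq> ?bad"
  proof (rule subsetI, rule ccontr)
    fix \<omega> assume \<omega>: "\<omega> \<in> {\<omega> \<in> space ?Q. ennreal T < sup_norm L (\<lambda>z u. ratio n \<omega> z u - l z u)}"
      and nb: "\<omega> \<notin> ?bad"
    have light: "light (snd (\<omega> i))" if "i < n" for i using N(1) \<omega> nb that by blast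
    have "\<bar>ratio n \<omega> z u - l z u\<bar> \<le> T" if z: "z \<in> unit_cube" and u: "u \<in> cltri L" for z u
    proof -
      obtain g where g: "g \<in> G" "norm (z - fst g) \<le> \<eta>" "norm (u - snd g) \<le> \<eta>" using net[OF z u] by blast
      have "\<omega> \<notin> B1 g" "\<omega> \<notin> B2 g" using nb g by auto
      then have "\<bar>num n \<omega> (fst g) (snd g) - expectation (X (fst g) (snd g))\<bar> \<le> \<epsilon>" "\<bar>den n \<omega> (fst g) - 1\<bar> \<le> \<epsilon>"
        using \<omega> by (auto simp: B1_def B2_def)
      from ratio_error[OF n light z mem(1)[OF g(1)] u mem(2)[OF g(1)] g(2,3) \<eta> \<epsilon> this]
      show ?thesis using T by linarith
    qed
    then have "sup_norm L (\<lambda>z u. ratio n \<omega> z u - l z u) \<le> ennreal T"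
      unfolding sup_norm_def by (intro SUP_least) (auto intro!: ennreal_leI)
    then show False using \<omega> by (auto simp: not_less[symmetric])
  qed
  moreover have sets: "?bad \<in> sets ?Q" by (intro sets.Un sets.finite_UN N G B1m B2m)
  ultimately have "sample_prob P n (\<lambda>\<omega>. ennreal T < sup_norm L (\<lambda>z u. ratio n \<omega> z u - l z u)) \<le> emeasure ?Q ?bad"
    unfolding sample_prob_def by (metis (no_types, lifting) outer_measure_of_mono outer_measure_of_eq)
  also have "\<dots> \<le> emeasure ?Q N + (emeasure ?Q (\<Union>g\<in>G. B1 g) + emeasure ?Q (\<Union>g\<in>G. B2 g))"
    by (intro order_trans[OF emeasure_subadditive add_left_mono] emeasure_subadditive
      sets.Un sets.finite_UN G N B1m B2m)
  also have "\<dots> \<le> 0 + ((\<Sum>g\<in>G. ?p) + (\<Sum>g\<in>G. ?p))"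
    using N(2)
    by (intro add_mono order_trans[OF emeasure_subadditive_finite sum_mono] B1 B2 G image_subsetI B1m B2m) simp_all
  also have "\<dots> = ennreal (4 * real (card G) * exp (- (n * \<epsilon>\<^sup>2 / (4 * (?b * ?\<mu>)))))"
    by (simp add: ennreal_of_nat_eq_real_of_nat ennreal_mult[symmetric] ennreal_plus[symmetric] del: ennreal_plus)
  also have "n * \<epsilon>\<^sup>2 / (4 * (?b * ?\<mu>)) = n * \<epsilon>\<^sup>2 * (hZ ^ CARD('n) * hU\<^sup>2) / (4 * (A\<^sup>2 * (Mw + 1) * ?\<mu>))"
    by simp
  finally show ?thesis .
qed

end

section \<open>Grids and the rate\<close>

definition grid_floor :: "real \<Rightarrow> nat \<Rightarrow> real \<Rightarrow> nat" where
  "grid_floor c N x = nat \<lfloor>x / c * N\<rfloor>"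

lemma grid_floor:
  assumes "0 < c" "0 < N" "0 \<le> x" "x \<le> c"
  shows "grid_floor c N x \<le> N" "c * grid_floor c N x / N \<le> x" "x - c * grid_floor c N x / N \<le> c / N"
proof -
  have 0: "0 \<le> x / c * N" using assms by simp
  then have eq: "real (grid_floor c N x) = of_int \<lfloor>x / c * N\<rfloor>" unfolding grid_floor_def by simp
  have "x / c * N \<le> 1 * real N" using assms by (intro mult_right_mono) auto
  then have "real (grid_floor c N x) \<le> real N" unfolding eq by linarith
  then show "grid_floor c N x \<le> N" by simp
  have "real (grid_floor c N x) \<le> x / c * N" unfolding eq by linarith
  then show "c * grid_floor c N x / N \<le> x" using assms by (simp add: field_simps)
  have "x / c * N \<le> real (grid_floor c N x) + 1" unfolding eq by linarith
  then have "x * N - c * grid_floor c N x \<le> c" using assms by (simp add: field_simps)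
  then have "(x * N - c * grid_floor c N x) / N \<le> c / N" by (rule divide_right_mono) simp
  then show "x - c * grid_floor c N x / N \<le> c / N" using assms by (simp add: diff_divide_distrib)
qed

lemma grid_floor_mono: "0 < c \<Longrightarrow> x \<le> y \<Longrightarrow> grid_floor c N x \<le> grid_floor c N y"
  unfolding grid_floor_def by (intro nat_mono floor_mono mult_right_mono divide_right_mono) auto

text \<open>Rounding down the coordinates is monotone, so it preserves both the cube and the constraint
  \<open>fst u \<le> snd u\<close> of the triangle: the net points are admissible.\<close>

lemma grid_net:
  fixes L :: real and N :: nat
  assumes L: "0 < L" and N: "0 < N"
  obtains G :: "((real ^ 'n) \<times> (real \<times> real)) set"
  where "finite G" "G \<subseteq> unit_cube \<times> cltri L" "card G \<le> (N + 1) ^ (CARD('n) + 2)"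
    "\<And>z u. z \<in> unit_cube \<Longrightarrow> u \<in> cltri L \<Longrightarrow>
      \<exists>g\<in>G. norm (z - fst g) \<le> (CARD('n) + 2 * L) / N \<and> norm (u - snd g) \<le> (CARD('n) + 2 * L) / N"
proof -
  define pt :: "('n \<Rightarrow> nat) \<times> nat \<times> nat \<Rightarrow> (real ^ 'n) \<times> (real \<times> real)"
    where "pt = (\<lambda>(k, a, b). (\<chi> i. 1 * real (k i) / N, (L * real a / N, L * real b / N)))"
  define I :: "(('n \<Rightarrow> nat) \<times> nat \<times> nat) set" where "I = (UNIV \<rightarrow>\<^sub>E {..N}) \<times> {..N} \<times> {..N::nat}"
  define G where "G = pt ` I \<inter> unit_cube \<times> cltri L"
  have I: "finite (UNIV \<rightarrow>\<^sub>E {..N} :: ('n \<Rightarrow> nat) set)" "finite I"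
    unfolding I_def by (auto intro!: finite_PiE)
  show thesis
  proof
    show "finite G" "G \<subseteq> unit_cube \<times> cltri L" using I by (auto simp: G_def)
    have "card G \<le> card (pt ` I)" unfolding G_def using I by (intro card_mono) auto
    also have "\<dots> \<le> card I" using I by (intro card_image_le)
    also have "\<dots> = (N + 1) ^ (CARD('n) + 2)"
      unfolding I_def by (simp add: card_cartesian_product card_PiE power_add power2_eq_square algebra_simps)
    finally show "card G \<le> (N + 1) ^ (CARD('n) + 2)" .
    fix z :: "real ^ 'n" and u assume z: "z \<in> unit_cube" and u: "u \<in> cltri L"
    have zi: "0 \<le> z $ i" "z $ i \<le> 1" for i using z by (auto simp: unit_cube_def mem_box_cart)
    have ui: "0 \<le> fst u" "fst u \<le> L" "0 \<le> snd u" "snd u \<le> L" "fst u \<le> snd u" using u by (auto simp: cltri_def)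
    define k where "k = ((\<lambda>i. grid_floor 1 N (z $ i)), grid_floor L N (fst u), grid_floor L N (snd u))"
    have "k \<in> I" using grid_floor(1)[OF zero_less_one N zi] grid_floor(1)[OF L N ui(1,2)] grid_floor(1)[OF L N ui(3,4)]
      by (auto simp: I_def k_def)
    moreover have "pt k \<in> unit_cube \<times> cltri L"
    proof -
      have "real (grid_floor 1 N (z $ i)) / N \<le> 1" for i
        using grid_floor(2)[OF zero_less_one N zi(1)[of i] zi(2)[of i]] zi[of i] by simp
      moreover have "L * real (grid_floor L N (fst u)) / N \<le> L * real (grid_floor L N (snd u)) / N"
        using grid_floor_mono[OF L ui(5), of N] L by (intro divide_right_mono mult_left_mono) auto
      moreover have "L * real (grid_floor L N (snd u)) / N \<le> L"
        using grid_floor(2)[OF L N ui(3,4)] ui by linarith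
      ultimately show ?thesis using L
        by (auto simp: pt_def k_def unit_cube_def mem_box_cart cltri_def)
    qed
    ultimately have "pt k \<in> G" by (auto simp: G_def)
    moreover have "norm (z - fst (pt k)) \<le> (CARD('n) + 2 * L) / N"
    proof -
      have "norm (z - fst (pt k)) \<le> (\<Sum>i\<in>UNIV. \<bar>(z - fst (pt k)) $ i\<bar>)" by (rule norm_le_l1_cart)
      also have "\<dots> \<le> (\<Sum>i\<in>(UNIV::'n set). 1 / N)"
      proof (rule sum_mono)
        fix i
        show "\<bar>(z - fst (pt k)) $ i\<bar> \<le> 1 / N"
          using grid_floor(2,3)[OF zero_less_one N zi(1)[of i] zi(2)[of i]] by (simp add: pt_def k_def)
      qed
      also have "\<dots> \<le> (CARD('n) + 2 * L) / N" using L by (simp add: divide_right_mono)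
      finally show ?thesis .
    qed
    moreover have "norm (u - snd (pt k)) \<le> (CARD('n) + 2 * L) / N"
    proof -
      have "norm (u - snd (pt k)) \<le> norm (fst (u - snd (pt k))) + norm (snd (u - snd (pt k)))"
        using norm_Pair_le[of "fst (u - snd (pt k))" "snd (u - snd (pt k))"] by (simp only: prod.collapse)
      also have "\<dots> \<le> L / N + L / N"
        using grid_floor(2,3)[OF L N ui(1,2)] grid_floor(2,3)[OF L N ui(3,4)]
        by (intro add_mono) (auto simp: pt_def k_def)
      also have "\<dots> \<le> (CARD('n) + 2 * L) / N" using L by (simp add: add_divide_distrib[symmetric] divide_right_mono)
      finally show ?thesis .
    qed
    ultimately show "\<exists>g\<in>G. norm (z - fst g) \<le> (CARD('n) + 2 * L) / N \<and> norm (u - snd g) \<le> (CARD('n) + 2 * L) / N"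
      by blast
  qed
qed

context smoothed_law
begin

text \<open>The choice of constants. With \<open>\<epsilon> = C1 * \<rho>\<close>, the identity \<open>n * \<rho>\<^sup>2 * r ^ (d + 2) = ln n\<close> (\<open>d\<close> being
  \<open>CARD('n)\<close>) makes the exponential a power \<open>n ^ -q\<close>, with \<open>q\<close> as large as \<open>C1\<close> demands. A grid
  of mesh \<open>n ^ -m\<close> with \<open>m = 2 * d + 8\<close> outweighs the Lipschitz constant of order \<open>n ^ (2 * d + 6)\<close>,
  and it has \<open>O(n ^ (m * (d + 2)))\<close> points, so \<open>q = m * (d + 2) + 1\<close> leaves a probability of
  order \<open>1 / n\<close>.\<close>

lemma rate_bound:
  fixes n :: nat and C1 r \<rho> cZ cZ' cU cU' :: real
  defines "\<kappa> \<equiv> CARD('n) + 2 * L"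
  assumes n: "0 < n" and c: "0 < cZ" "0 < cU" "0 < C1"
    and h: "cZ * r \<le> hZ" "hZ \<le> cZ' * r" "cU * r \<le> hU" "hU \<le> cU' * r"
    and r: "1 / n \<le> r" and \<rho>: "1 / n \<le> \<rho>" "r powr s = \<rho>" "n * \<rho>\<^sup>2 * r ^ (CARD('n) + 2) = ln n"
    and large: "\<kappa> \<le> cZ * n" "\<kappa> \<le> cU * n" "C1 * \<rho> \<le> 1 / 4"
      "2 * A\<^sup>2 * (Mw + 1) * \<kappa> \<le> cZ ^ (2 * CARD('n) + 1) * cU ^ 5 * (C1 * n)"
    and C1: "real ((2 * CARD('n) + 8) * (CARD('n) + 2) + 1) * (4 * (A\<^sup>2 * (Mw + 1) * (l_max + LH * 2 powr s + 1)))
      \<le> C1\<^sup>2 * (cZ ^ CARD('n) * cU\<^sup>2)"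
  shows "sample_prob P n (\<lambda>\<omega>. ennreal (4 * (C1 * (1 + l_max) + LH * (cZ' + cU') powr s) * \<rho>)
      < sup_norm L (\<lambda>z u. ratio n \<omega> z u - l z u)) \<le> ennreal (4 * 2 ^ (CARD('n) + 2) / n)"
proof -
  let ?d = "CARD('n)"
  define m where "m = 2 * ?d + 8"
  define q where "q = m * (?d + 2) + 1"
  define N where "N = n ^ m"
  define \<epsilon> where "\<epsilon> = C1 * \<rho>"
  define K where "K = 4 * (A\<^sup>2 * (Mw + 1) * (l_max + LH * 2 powr s + 1))"
  have n0: "0 < real n" "1 \<le> real n" using n by auto
  have r0: "0 < r" using r n0 by (smt (verit) divide_pos_pos)
  have \<rho>0: "0 < \<rho>" using \<rho>(1) n0 by (smt (verit) divide_pos_pos)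
  have \<kappa>: "0 < \<kappa>" using L_pos by (simp add: \<kappa>_def add_pos_pos)
  have N: "0 < N" using n by (simp add: N_def)
  have hn: "cZ / n \<le> hZ" "cU / n \<le> hU"
    using mult_left_mono[OF r, of cZ] mult_left_mono[OF r, of cU] c h by auto
  have K: "0 < K" unfolding K_def using A Mw_pos l_max_nonneg LH_pos
    by (intro mult_pos_pos) (auto intro!: add_nonneg_pos add_nonneg_nonneg)
  have \<epsilon>0: "0 < \<epsilon>" using c \<rho>0 by (simp add: \<epsilon>_def)
  have \<kappa>N: "\<kappa> / N \<le> c / n" if "\<kappa> \<le> c * n" for c :: real
  proof -
    have "real n ^ 2 \<le> real n ^ m" using n0 by (intro power_increasing) (auto simp: m_def)
    then have "\<kappa> / N \<le> \<kappa> / real n ^ 2" using \<kappa> n0 unfolding N_def by (intro divide_left_mono) auto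
    also have "\<dots> \<le> (c * n) / real n ^ 2" using that by (intro divide_right_mono) auto
    also have "\<dots> = c / n" using n0 by (simp add: power2_eq_square)
    finally show ?thesis .
  qed
  obtain G :: "((real ^ 'n) \<times> (real \<times> real)) set" where G: "finite G" "G \<subseteq> unit_cube \<times> cltri L"
    and card: "card G \<le> (N + 1) ^ (?d + 2)"
    and net: "\<And>z u. z \<in> unit_cube \<Longrightarrow> u \<in> cltri L \<Longrightarrow>
      \<exists>g\<in>G. norm (z - fst g) \<le> \<kappa> / N \<and> norm (u - snd g) \<le> \<kappa> / N"
    unfolding \<kappa>_def using grid_net[OF L_pos N] by blast
  have lip: "2 * A\<^sup>2 * (Mw + 1) * (\<kappa> / N) / (hZ ^ (2 * ?d + 1) * hU ^ 5) \<le> \<epsilon>"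
  proof -
    let ?c = "cZ ^ (2 * ?d + 1) * cU ^ 5"
    have "?c / real n ^ (2 * ?d + 6) = (cZ / n) ^ (2 * ?d + 1) * (cU / n) ^ 5"
    proof -
      have "real n ^ (2 * ?d + 6) = real n ^ (2 * ?d + 1) * real n ^ 5"
        unfolding power_add[symmetric] by (rule arg_cong[where f = "(^) (real n)"]) simp
      then show ?thesis by (simp add: power_divide)
    qed
    also have "\<dots> \<le> hZ ^ (2 * ?d + 1) * hU ^ 5"
      using hn c n0 hZ hU by (intro mult_mono power_mono) auto
    finally have low: "?c / real n ^ (2 * ?d + 6) \<le> hZ ^ (2 * ?d + 1) * hU ^ 5" .
    have "2 * A\<^sup>2 * (Mw + 1) * (\<kappa> / N) / (hZ ^ (2 * ?d + 1) * hU ^ 5)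
        \<le> 2 * A\<^sup>2 * (Mw + 1) * (\<kappa> / N) / (?c / real n ^ (2 * ?d + 6))"
      using low \<kappa> A Mw_pos n0 c hZ hU by (intro divide_left_mono mult_pos_pos mult_nonneg_nonneg) auto
    also have "\<dots> = (2 * A\<^sup>2 * (Mw + 1) * \<kappa>) / (?c * real n ^ 2)"
    proof -
      have "real N = real n ^ (2 * ?d + 6) * real n ^ 2"
        unfolding N_def m_def of_nat_power power_add[symmetric]
        by (rule arg_cong[where f = "(^) (real n)"]) simp
      then show ?thesis using n0 by simp
    qed
    also have "\<dots> \<le> (?c * (C1 * n)) / (?c * real n ^ 2)"
      using large(4) c n0 by (intro divide_right_mono) auto
    also have "\<dots> = C1 * (1 / n)" using c n0 by (simp add: power2_eq_square)
    also have "\<dots> \<le> \<epsilon>" unfolding \<epsilon>_def using \<rho>(1) c by (intro mult_left_mono) auto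
    finally show ?thesis .
  qed
  have bias: "bias \<le> LH * (cZ' + cU') powr s * \<rho>"
  proof -
    have le: "hZ + hU \<le> (cZ' + cU') * r" using h by (simp add: distrib_right)
    then have "0 < (cZ' + cU') * r" using hZ hU by linarith
    then have pos: "0 < cZ' + cU'" using r0 by (simp add: zero_less_mult_iff)
    have "bias \<le> LH * ((cZ' + cU') * r) powr s"
      using le hZ hU s_pos LH_pos by (intro mult_left_mono powr_mono2) auto
    then show ?thesis using pos r0 \<rho>(2) by (simp add: powr_mult)
  qed
  have "sample_prob P n (\<lambda>\<omega>. ennreal (4 * (C1 * (1 + l_max) + LH * (cZ' + cU') powr s) * \<rho>)
      < sup_norm L (\<lambda>z u. ratio n \<omega> z u - l z u)) \<le>
    ennreal (4 * real (card G) * exp (- (n * \<epsilon>\<^sup>2 * (hZ ^ ?d * hU\<^sup>2) / K)))"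
    unfolding K_def
  proof (rule finite_sample_bound[OF n G net lip])
    show "\<kappa> / N \<le> hZ" "\<kappa> / N \<le> hU" using \<kappa>N[OF large(1)] \<kappa>N[OF large(2)] hn by linarith+
    show "0 < \<epsilon>" "\<epsilon> \<le> 1 / 4" using \<epsilon>0 large(3) by (auto simp: \<epsilon>_def)
    show "4 * (\<epsilon> + bias + l_max * \<epsilon>) \<le> 4 * (C1 * (1 + l_max) + LH * (cZ' + cU') powr s) * \<rho>"
      using bias by (simp add: \<epsilon>_def algebra_simps)
  qed
  also have "4 * real (card G) * exp (- (n * \<epsilon>\<^sup>2 * (hZ ^ ?d * hU\<^sup>2) / K)) \<le> 4 * (2 * real n ^ m) ^ (?d + 2) * (1 / real n ^ q)"
  proof (rule mult_mono)
    have "real (card G) \<le> real ((N + 1) ^ (?d + 2))" using card by (rule of_nat_mono)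
    also have "\<dots> \<le> (2 * real n ^ m) ^ (?d + 2)"
      unfolding of_nat_power using N by (intro power_mono) (auto simp: N_def)
    finally show "4 * real (card G) \<le> 4 * (2 * real n ^ m) ^ (?d + 2)" by simp
    have "q * ln n \<le> n * \<epsilon>\<^sup>2 * (hZ ^ ?d * hU\<^sup>2) / K"
    proof -
      have "real q * ln n * K = real q * K * (n * \<rho>\<^sup>2 * r ^ (?d + 2))" unfolding \<rho>(3) by simp
      also have "\<dots> \<le> C1\<^sup>2 * (cZ ^ ?d * cU\<^sup>2) * (n * \<rho>\<^sup>2 * r ^ (?d + 2))"
        using C1 r0 unfolding K_def q_def m_def by (intro mult_right_mono) auto
      also have "\<dots> = n * \<epsilon>\<^sup>2 * ((cZ * r) ^ ?d * (cU * r)\<^sup>2)"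
        by (simp add: \<epsilon>_def power_mult_distrib power_add power2_eq_square mult_ac)
      also have "\<dots> \<le> n * \<epsilon>\<^sup>2 * (hZ ^ ?d * hU\<^sup>2)"
        using h c r0 hZ by (intro mult_left_mono mult_mono power_mono) auto
      finally show ?thesis using K by (simp add: pos_le_divide_eq)
    qed
    then have "exp (- (n * \<epsilon>\<^sup>2 * (hZ ^ ?d * hU\<^sup>2) / K)) \<le> exp (- (q * ln n))" by simp
    also have "\<dots> = 1 / real n ^ q" using n0 by (simp add: exp_minus exp_of_nat_mult divide_inverse)
    finally show "exp (- (n * \<epsilon>\<^sup>2 * (hZ ^ ?d * hU\<^sup>2) / K)) \<le> 1 / real n ^ q" .
  qed (auto)
  also have "4 * (2 * real n ^ m) ^ (?d + 2) * (1 / real n ^ q) = 4 * 2 ^ (?d + 2) / n"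
  proof -
    have "real n ^ q = (real n ^ m) ^ (?d + 2) * n" unfolding q_def power_mult[symmetric] by (simp add: power_add mult.commute)
    then show ?thesis using n0 unfolding power_mult_distrib by simp
  qed
  finally show ?thesis by (simp add: ennreal_leI)
qed

end

theorem mainTheorem4:
  fixes L s LH Mw \<delta> cZ cZ' cU cU' :: real
    and w :: "real \<times> real \<Rightarrow> real"
    and KZ :: "real ^ 'n \<Rightarrow> real"
    and KU :: "real \<times> real \<Rightarrow> real"
  assumes "L > 0" and "0 < s" and "s \<le> 1" and "LH > 0" and "Mw > 0"
    and "\<forall>u\<in>cltri L. 0 \<le> w u"
    and "bounded (w ` cltri L)"
    and "\<exists>B. B-lipschitz_on (cltri L) w"
    and "\<forall>u\<in>diag L. w u = 0"
    and "\<forall>u\<in>tri L. w u > 0"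
    and "smoothing_kernel KZ" and "smoothing_kernel KU"
    and "0 < cZ" and "0 < cZ'" and "0 < cU" and "0 < cU'"
    and "0 < \<delta>" and "\<delta> < 1"
  shows "\<exists>C>0. \<forall>hZ hU :: nat \<Rightarrow> real.
           asymp_equiv_consts cZ cZ' hZ (bandwidth_rate CARD('n) s) \<longrightarrow>
           asymp_equiv_consts cU cU' hU (bandwidth_rate CARD('n) s) \<longrightarrow>
           (\<forall>\<^sub>F n in sequentially.
             (SUP P \<in> (P_bm L w s LH Mw :: ((real ^ 'n) \<times> diagram) measure set).
                sample_prob P n
                  (\<lambda>\<omega>. sup_norm L (\<lambda>z u. intensity_estimator L w KZ KU (hZ n) (hU n) n \<omega> z u
                                            - cond_intensity L w s LH P z u)
                        > ennreal (C * risk_rate CARD('n) s n)))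
             \<le> ennreal \<delta>)"
proof -
  interpret diagram_weight L w
    using assms by unfold_locales (auto dest: lipschitz_on_continuous_on)
  let ?d = "CARD('n)"
  have cube: "compact (unit_cube :: (real^'n) set)" "convex (unit_cube :: (real^'n) set)"
    "0 < measure lborel (unit_cube :: (real^'n) set)"
    by (auto simp: unit_cube_def[symmetric] measure_def emeasure_unit_cube) (auto simp: unit_cube_def)
  obtain AZ where AZ: "1 \<le> AZ" "\<And>h. 0 < h \<Longrightarrow> h \<le> 1 \<Longrightarrow> controlled_kernel unit_cube AZ h (corrected_kernel unit_cube KZ h)"
    using corrected_kernel_controlled[OF \<open>smoothing_kernel KZ\<close> cube] by blast
  obtain AU where AU: "1 \<le> AU" "\<And>h. 0 < h \<Longrightarrow> h \<le> 1 \<Longrightarrow> controlled_kernel (cltri L) AU h (corrected_kernel (cltri L) KU h)"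
    using corrected_kernel_controlled[OF \<open>smoothing_kernel KU\<close> compact_cltri convex_cltri measure_cltri_pos[OF \<open>L > 0\<close>]] by blast
  define A where "A = max AZ AU"
  have A: "1 \<le> A" using AZ by (simp add: A_def)
  define \<Lambda> where "\<Lambda> = Mw / measure lborel (cltri L) + LH * (diameter (unit_cube :: (real^'n) set) + diameter (cltri L)) powr s"
  have \<Lambda>0: "0 \<le> \<Lambda>" using assms by (simp add: \<Lambda>_def)
  define K where "K = real ((2 * ?d + 8) * (?d + 2) + 1) * (4 * (A\<^sup>2 * (Mw + 1) * (\<Lambda> + LH * 2 powr s + 1)))"
  have K: "0 < K" unfolding K_def using A assms \<Lambda>0
    by (intro mult_pos_pos) (auto intro!: add_nonneg_pos add_nonneg_nonneg)
  \<comment> \<open>The value for which the deviation exponent is exactly the power of \<open>n\<close> needed to beat the grid.\<close>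
  define C1 where "C1 = sqrt (K / (cZ ^ ?d * cU\<^sup>2))"
  have C1: "0 < C1" "C1\<^sup>2 * (cZ ^ ?d * cU\<^sup>2) = K" using K assms by (auto simp: C1_def)
  define C where "C = 4 * (C1 * (1 + \<Lambda>) + LH * (cZ' + cU') powr s)"
  define D where "D = 2 * s + real ?d + 2"
  have D: "1 \<le> D" "s \<le> D" using assms by (auto simp: D_def)
  define \<kappa> where "\<kappa> = ?d + 2 * L"
  define x where "x n = ln (real n) / real n" for n :: nat
  have x_lim: "x \<longlonglongrightarrow> 0" unfolding x_def using lim_ln_over_n by simp
  have r_eq: "bandwidth_rate ?d s n = x n powr (1 / D)" and rho_eq: "risk_rate ?d s n = x n powr (s / D)" for n
    by (simp_all add: bandwidth_rate_def risk_rate_def x_def D_def)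
  have x_nonneg: "\<forall>\<^sub>F n in sequentially. 0 \<le> x n"
    using eventually_ge_at_top[of 1] by eventually_elim (simp add: x_def)
  have r_lim: "(\<lambda>n. bandwidth_rate ?d s n) \<longlonglongrightarrow> 0" and rho_lim: "(\<lambda>n. risk_rate ?d s n) \<longlonglongrightarrow> 0"
    unfolding r_eq rho_eq using D assms x_lim x_nonneg by (auto intro!: tendsto_zero_powrI)
  have real_large: "\<forall>\<^sub>F n in sequentially. a \<le> real n" for a
    using filterlim_real_sequentially by (simp add: filterlim_at_top)
  show ?thesis
  proof (intro exI[of _ C] conjI allI impI)
    show "0 < C" using C1 \<Lambda>0 assms by (auto simp: C_def intro!: add_pos_nonneg mult_pos_pos)
    fix hZ hU :: "nat \<Rightarrow> real"
    let ?r = "bandwidth_rate ?d s" and ?\<rho> = "risk_rate ?d s"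
    assume "asymp_equiv_consts cZ cZ' hZ ?r" and "asymp_equiv_consts cU cU' hU ?r"
    then have eqv: "\<forall>\<^sub>F n in sequentially. cZ \<le> hZ n / ?r n \<and> hZ n / ?r n \<le> cZ'"
      "\<forall>\<^sub>F n in sequentially. cU \<le> hU n / ?r n \<and> hU n / ?r n \<le> cU'"
      by (simp_all add: asymp_equiv_consts_def)
    have small: "\<forall>\<^sub>F n in sequentially. ?r n < 1 / cZ'" "\<forall>\<^sub>F n in sequentially. ?r n < 1 / cU'"
      "\<forall>\<^sub>F n in sequentially. ?\<rho> n < 1 / (4 * C1)"
      using order_tendstoD(2)[OF r_lim] order_tendstoD(2)[OF rho_lim] assms C1 by auto
    show "\<forall>\<^sub>F n in sequentially.
      (SUP P \<in> (P_bm L w s LH Mw :: ((real ^ 'n) \<times> diagram) measure set).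
        sample_prob P n (\<lambda>\<omega>. sup_norm L (\<lambda>z u. intensity_estimator L w KZ KU (hZ n) (hU n) n \<omega> z u
            - cond_intensity L w s LH P z u) > ennreal (C * ?\<rho> n))) \<le> ennreal \<delta>"
      using eqv small eventually_ge_at_top[of "3::nat"] real_large[of "\<kappa> / cZ"] real_large[of "\<kappa> / cU"]
        real_large[of "2 * A\<^sup>2 * (Mw + 1) * \<kappa> / (cZ ^ (2 * ?d + 1) * cU ^ 5 * C1)"]
        real_large[of "4 * 2 ^ (?d + 2) / \<delta>"]
    proof eventually_elim
      case (elim n)
      have n: "0 < n" "0 < real n" using elim by auto
      have "exp 1 \<le> real n" using elim(6) exp_le by linarith
      then have ln1: "1 \<le> ln (real n)" using n by (simp add: ln_ge_iff)
      have xn: "1 / n \<le> x n" "x n \<le> 1" "0 < x n"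
        using ln1 n ln_le_minus_one[of "real n"] by (auto simp: x_def divide_right_mono)
      have r: "0 < ?r n" "1 / n \<le> ?r n"
        unfolding r_eq using xn D powr_mono'[of "1 / D" 1 "x n"] by auto
      have \<rho>: "0 < ?\<rho> n" "1 / n \<le> ?\<rho> n"
        unfolding rho_eq using xn D assms powr_mono'[of "s / D" 1 "x n"] by auto
      have h: "cZ * ?r n \<le> hZ n" "hZ n \<le> cZ' * ?r n" "cU * ?r n \<le> hU n" "hU n \<le> cU' * ?r n"
        using elim r by (auto simp: field_simps)
      have hZ: "0 < hZ n" "hZ n \<le> 1"
        using h r elim(3) assms by (auto simp: field_simps intro: less_le_trans[of 0 "cZ * ?r n"])
      have hU: "0 < hU n" "hU n \<le> 1"
        using h r elim(4) assms by (auto simp: field_simps intro: less_le_trans[of 0 "cU * ?r n"])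
      show ?case
      proof (rule SUP_least)
        fix P :: "((real ^ 'n) \<times> diagram) measure"
        assume P: "P \<in> P_bm L w s LH Mw"
        let ?l = "cond_intensity L w s LH P"
        have "\<exists>l. l \<in> holder_class L s LH \<and> is_cond_intensity L w P l" using P by (auto simp: P_bm_def)
        then have l: "?l \<in> holder_class L s LH" "is_cond_intensity L w P ?l"
          unfolding cond_intensity_def by (metis (mono_tags, lifting) someI_ex)+
        have Pf: "prob_space P" "sets P = sets (borel \<Otimes>\<^sub>M diagram_space L)"
          "distr P borel fst = uniform_measure lborel unit_cube"
          "AE \<omega> in P. emeasure (weighted_measure L w (snd \<omega>)) (cltri L) \<le> ennreal Mw"
          using P unfolding P_bm_def by simp_all
        interpret prob_space P by (fact Pf)
        interpret smoothed_law L w P s LH Mw ?l "corrected_kernel unit_cube KZ (hZ n)"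
          "corrected_kernel (cltri L) KU (hU n)" A "hZ n" "hU n"
        proof unfold_locales
          show "controlled_kernel unit_cube A (hZ n) (corrected_kernel unit_cube KZ (hZ n))"
            by (rule controlled_kernel_mono[OF AZ(2)[OF hZ] _ hZ(1)]) (simp add: A_def)
          show "controlled_kernel (cltri L) A (hU n) (corrected_kernel (cltri L) KU (hU n))"
            by (rule controlled_kernel_mono[OF AU(2)[OF hU] _ hU(1)]) (simp add: A_def)
        qed (fact Pf l A hZ hU assms(1,2,4,5))+
        \<comment> \<open>The intensity bound is the same for every \<open>P\<close>, and with it \<open>C\<close>.\<close>
        have lmax: "l_max = \<Lambda>" by (simp add: l_max_def \<Lambda>_def)
        have est: "ratio n \<omega> z u = intensity_estimator L w KZ KU (hZ n) (hU n) n \<omega> z u" for \<omega> z u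
          by (simp add: ratio_def intensity_estimator_def Y_def smoothed_diagram_def Let_def)
        have "sample_prob P n (\<lambda>\<omega>. ennreal (4 * (C1 * (1 + l_max) + LH * (cZ' + cU') powr s) * ?\<rho> n)
            < sup_norm L (\<lambda>z u. ratio n \<omega> z u - ?l z u)) \<le> ennreal (4 * 2 ^ (?d + 2) / n)"
        proof (rule rate_bound[OF n(1) _ _ C1(1) h r(2) \<rho>(2)])
          show "?r n powr s = ?\<rho> n" by (simp add: r_eq rho_eq powr_powr)
          have "(?\<rho> n)\<^sup>2 * ?r n ^ (?d + 2) = x n powr (s / D * 2) * x n powr (1 / D * (?d + 2))"
          proof -
            have "(x n powr a) ^ k = x n powr (a * real k)" for a k
              using xn by (subst powr_realpow[symmetric]) (auto simp: powr_powr)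
            from this[of "s / D" 2] this[of "1 / D" "?d + 2"] show ?thesis unfolding r_eq rho_eq by simp
          qed
          also have "\<dots> = x n powr ((2 * s + ?d + 2) / D)"
            by (simp add: powr_add[symmetric] add_divide_distrib algebra_simps)
          also have "\<dots> = x n" using xn D by (simp add: D_def)
          finally show "n * (?\<rho> n)\<^sup>2 * ?r n ^ (?d + 2) = ln n" using n by (simp add: x_def mult.assoc)
          show "?d + 2 * L \<le> cZ * n" "?d + 2 * L \<le> cU * n"
            using elim(7,8) assms by (auto simp: \<kappa>_def field_simps)
          show "C1 * ?\<rho> n \<le> 1 / 4" using elim(5) C1 by (simp add: field_simps)
          show "2 * A\<^sup>2 * (Mw + 1) * (?d + 2 * L) \<le> cZ ^ (2 * ?d + 1) * cU ^ 5 * (C1 * n)"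
            using elim(9) assms C1(1) unfolding \<kappa>_def[symmetric] by (subst (asm) pos_divide_le_eq) (auto simp: mult_ac)
          show "real ((2 * ?d + 8) * (?d + 2) + 1) * (4 * (A\<^sup>2 * (Mw + 1) * (l_max + LH * 2 powr s + 1)))
              \<le> C1\<^sup>2 * (cZ ^ ?d * cU\<^sup>2)" unfolding C1(2) lmax K_def by simp
        qed (use assms in auto)
        also have "ennreal (4 * 2 ^ (?d + 2) / n) \<le> ennreal \<delta>"
          using elim(10) n \<open>0 < \<delta>\<close> by (intro ennreal_leI) (simp add: field_simps)
        finally show "sample_prob P n (\<lambda>\<omega>. sup_norm L (\<lambda>z u. intensity_estimator L w KZ KU (hZ n) (hU n) n \<omega> z u
            - ?l z u) > ennreal (C * ?\<rho> n)) \<le> ennreal \<delta>"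
          unfolding est lmax C_def .
      qed
    qed
  qed
qed

end
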